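(* Let $\mathfrak{h} = \mathfrak{n}_4$ be the nilpotent Lie algebra with basis $f_1,f_2,f_3,f_4$ and nonzero brackets $[f_1,f_2]=f_3$, $[f_1,f_3]=f_4$. Let $\mathfrak{g}$ be (isomorphic to) one of the following $4$-dimensional solvable Lie algebras, which are those non-nilpotent algebras in the paper's table whose nilshadow is $\mathfrak{rh}_3 = \mathfrak{h}_3\oplus\mathbb{R}$: $\mathfrak{rr}_3$, $\mathfrak{r}_{4,\lambda}$ ($\lambda\in\mathbb{R}$), $\mathfrak{d}_4$, $\mathfrak{d}_{4,\lambda}$ ($\lambda\geq\frac12$), $\mathfrak{d}'_{4,\lambda}$ ($\lambda\geq 0$). There exists a simply transitive action $\varphi: \mathfrak{g} \to \mathrm{aff}(\mathfrak{h})$ if and only if $\mathfrak{g}$ is isomorphic to $\mathfrak{r}_{4,\lambda}$ with $\lambda\in\{-1,\frac12,1\}$, or to $\mathfrak{d}_{4,\lambda}$ with $\lambda\in\{\frac12,2\}$.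
   Context: All Lie algebras and Lie groups are real and finite-dimensional; $1$-connected means connected and simply connected. For a $1$-connected nilpotent Lie group $H$ with Lie algebra $\mathfrak{h}$, $\mathrm{Aff}(H) = H \rtimes \mathrm{Aut}(H)$ acts on $H$ by $(h,\alpha)\cdot x = h\,\alpha(x)$, and its Lie algebra is $\mathrm{aff}(\mathfrak{h}) = \mathfrak{h}\rtimes\mathrm{Der}(\mathfrak{h})$. A simply transitive action $\varphi: \mathfrak{g}\to\mathrm{aff}(\mathfrak{h})$ is a Lie algebra morphism such that, for the $1$-connected Lie groups $G$, $H$ with Lie algebras $\mathfrak{g}$, $\mathfrak{h}$, the Lie group morphism $G \to \mathrm{Aff}(H)$ with differential $\varphi$ makes $G$ act simply transitively on $H$. The Lie algebras are given on a basis $e_1,e_2,e_3,e_4$ by the following nonzero brackets: $\mathfrak{rr}_3$: $[e_1,e_2]=e_2$, $[e_1,e_3]=e_2+e_3$. $\mathfrak{r}_{4,\lambda}$: $[e_1,e_2]=e_2$, $[e_1,e_3]=\lambda e_3$, $[e_1,e_4]=e_3+\lambda e_4$. $\mathfrak{d}_4$: $[e_1,e_2]=e_2$, $[e_1,e_3]=-e_3$, $[e_2,e_3]=e_4$. $\mathfrak{d}_{4,\lambda}$: $[e_1,e_2]=\lambda e_2$, $[e_1,e_3]=(1-\lambda)e_3$, $[e_1,e_4]=e_4$, $[e_2,e_3]=e_4$. $\mathfrak{d}'_{4,\lambda}$: $[e_1,e_2]=\lambda e_2-e_3$, $[e_1,e_3]=e_2+\lambda e_3$, $[e_1,e_4]=2\lambda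 e_4$, $[e_2,e_3]=e_4$. The nilshadow of a solvable Lie algebra $\mathfrak{g}$ is the nilradical of its semisimple splitting; it is only used here to describe which algebras $\mathfrak{g}$ are considered, and these are listed explicitly. *)

theory Defs
  imports "HOL-Analysis.Analysis" "HOL-Algebra.Group"
begin

section \<open>Real Lie algebras\<close>

definition lie_algebra :: "('g::real_vector \<Rightarrow> 'g \<Rightarrow> 'g) \<Rightarrow> bool" where
  "lie_algebra br \<longleftrightarrow>
     (\<forall>x. linear (br x)) \<and> (\<forall>y. linear (\<lambda>x. br x y)) \<and> (\<forall>x. br x x = 0) \<and>
     (\<forall>x y z. br x (br y z) + br y (br z x) + br z (br x y) = 0)"

definition lie_isomorphic ::
  "('g::real_vector \<Rightarrow> 'g \<Rightarrow> 'g) \<Rightarrow> ('k::real_vector \<Rightarrow> 'k \<Rightarrow> 'k) \<Rightarrow> bool" where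
  "lie_isomorphic br br' \<longleftrightarrow>
     (\<exists>f. linear f \<and> bij f \<and> (\<forall>x y. f (br x y) = br' (f x) (f y)))"

definition derivations :: "('h::real_normed_vector \<Rightarrow> 'h \<Rightarrow> 'h) \<Rightarrow> ('h \<Rightarrow>\<^sub>L 'h) set" where
  "derivations br = {D :: 'h \<Rightarrow>\<^sub>L 'h. \<forall>x y. D (br x y) = br (D x) y + br x (D y)}"

text \<open>The Lie algebra \<open>aff(\<hh>) = \<hh> \<rtimes> Der(\<hh>)\<close>; on a finite-dimensional space every endomorphism is
  bounded, so \<open>'h \<Rightarrow>\<^sub>L 'h\<close> is \<open>End(\<hh>)\<close>.\<close>

definition aff_carrier :: "('h::real_normed_vector \<Rightarrow> 'h \<Rightarrow> 'h) \<Rightarrow> ('h \<times> ('h \<Rightarrow>\<^sub>L 'h)) set" where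
  "aff_carrier br = UNIV \<times> derivations br"

definition aff_bracket ::
  "('h::real_normed_vector \<Rightarrow> 'h \<Rightarrow> 'h) \<Rightarrow>
     'h \<times> ('h \<Rightarrow>\<^sub>L 'h) \<Rightarrow> 'h \<times> ('h \<Rightarrow>\<^sub>L 'h) \<Rightarrow> 'h \<times> ('h \<Rightarrow>\<^sub>L 'h)" where
  "aff_bracket br = (\<lambda>(x, D) (y, E).
     (br x y + blinfun_apply D y - blinfun_apply E x, (D o\<^sub>L E) - (E o\<^sub>L D)))"

definition aff_morphism ::
  "('g::real_vector \<Rightarrow> 'g \<Rightarrow> 'g) \<Rightarrow> ('h::real_normed_vector \<Rightarrow> 'h \<Rightarrow> 'h) \<Rightarrow>
     ('g \<Rightarrow> 'h \<times> ('h \<Rightarrow>\<^sub>L 'h)) \<Rightarrow> bool" where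
  "aff_morphism brg brh \<phi> \<longleftrightarrow>
     linear \<phi> \<and> range \<phi> \<subseteq> aff_carrier brh \<and>
     (\<forall>x y. \<phi> (brg x y) = aff_bracket brh (\<phi> x) (\<phi> y))"


section \<open>The four-dimensional Lie algebras\<close>

abbreviation ee :: "4 \<Rightarrow> real^4" where "ee i \<equiv> axis i 1"

text \<open>\<open>cf x y i j\<close> is the coefficient with which \<open>[e\<^sub>i, e\<^sub>j]\<close> enters \<open>[x, y]\<close>.\<close>

definition cf :: "real^4 \<Rightarrow> real^4 \<Rightarrow> 4 \<Rightarrow> 4 \<Rightarrow> real" where
  "cf x y i j = x $ i * y $ j - x $ j * y $ i"

definition rr3 :: "real^4 \<Rightarrow> real^4 \<Rightarrow> real^4" where
  "rr3 x y = cf x y 1 2 *\<^sub>R ee 2 + cf x y 1 3 *\<^sub>R (ee 2 + ee 3)"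

definition r4 :: "real \<Rightarrow> real^4 \<Rightarrow> real^4 \<Rightarrow> real^4" where
  "r4 \<mu> x y = cf x y 1 2 *\<^sub>R ee 2 + cf x y 1 3 *\<^sub>R (\<mu> *\<^sub>R ee 3)
     + cf x y 1 4 *\<^sub>R (ee 3 + \<mu> *\<^sub>R ee 4)"

definition d4 :: "real^4 \<Rightarrow> real^4 \<Rightarrow> real^4" where
  "d4 x y = cf x y 1 2 *\<^sub>R ee 2 + cf x y 1 3 *\<^sub>R (- ee 3) + cf x y 2 3 *\<^sub>R ee 4"

definition d4l :: "real \<Rightarrow> real^4 \<Rightarrow> real^4 \<Rightarrow> real^4" where
  "d4l \<mu> x y = cf x y 1 2 *\<^sub>R (\<mu> *\<^sub>R ee 2) + cf x y 1 3 *\<^sub>R ((1 - \<mu>) *\<^sub>R ee 3)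
     + cf x y 1 4 *\<^sub>R ee 4 + cf x y 2 3 *\<^sub>R ee 4"

definition d4l' :: "real \<Rightarrow> real^4 \<Rightarrow> real^4 \<Rightarrow> real^4" where
  "d4l' \<mu> x y = cf x y 1 2 *\<^sub>R (\<mu> *\<^sub>R ee 2 - ee 3) + cf x y 1 3 *\<^sub>R (ee 2 + \<mu> *\<^sub>R ee 3)
     + cf x y 1 4 *\<^sub>R ((2 * \<mu>) *\<^sub>R ee 4) + cf x y 2 3 *\<^sub>R ee 4"

definition n4 :: "real^4 \<Rightarrow> real^4 \<Rightarrow> real^4" where
  "n4 x y = cf x y 1 2 *\<^sub>R ee 3 + cf x y 1 3 *\<^sub>R ee 4"


section \<open>Smooth manifolds\<close>

primrec differentiable_times_on ::
  "nat \<Rightarrow> 'a::euclidean_space set \<Rightarrow> ('a \<Rightarrow> 'b::real_normed_vector) \<Rightarrow> bool" where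
  "differentiable_times_on 0 S f \<longleftrightarrow> continuous_on S f"
| "differentiable_times_on (Suc k) S f \<longleftrightarrow>
     (\<forall>x\<in>S. f differentiable (at x)) \<and>
     (\<forall>v. differentiable_times_on k S (\<lambda>x. frechet_derivative f (at x) v))"

definition smooth_on :: "'a::euclidean_space set \<Rightarrow> ('a \<Rightarrow> 'b::real_normed_vector) \<Rightarrow> bool" where
  "smooth_on S f \<longleftrightarrow> (\<forall>k. differentiable_times_on k S f)"

text \<open>A chart is a pair \<open>(U, c)\<close> of an open set and a homeomorphism of it onto an open subset of a
  Euclidean space. The carrier type \<open>'a\<close> only supplies points: the topology is a separate datum and
  has nothing to do with a topology that \<open>'a\<close> may have as a type.\<close>

type_synonym ('a, 'e) chart = "'a set \<times> ('a \<Rightarrow> 'e)"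

definition smooth_manifold :: "'a topology \<Rightarrow> ('a, 'e::euclidean_space) chart set \<Rightarrow> bool" where
  "smooth_manifold X A \<longleftrightarrow>
     Hausdorff_space X \<and> second_countable X \<and> (\<Union>(U, c)\<in>A. U) = topspace X \<and>
     (\<forall>(U, c)\<in>A. openin X U \<and> open (c ` U) \<and>
        homeomorphic_map (subtopology X U) (top_of_set (c ` U)) c) \<and>
     (\<forall>(U, c)\<in>A. \<forall>(V, d)\<in>A. smooth_on (c ` (U \<inter> V)) (d \<circ> inv_into U c))"

definition smooth_map ::
  "'a topology \<Rightarrow> ('a, 'e::euclidean_space) chart set \<Rightarrow>
   'b topology \<Rightarrow> ('b, 'f::euclidean_space) chart set \<Rightarrow> ('a \<Rightarrow> 'b) \<Rightarrow> bool" where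
  "smooth_map X A Y B f \<longleftrightarrow>
     continuous_map X Y f \<and>
     (\<forall>(U, c)\<in>A. \<forall>(V, d)\<in>B. smooth_on (c ` (U \<inter> f -` V)) (d \<circ> f \<circ> inv_into U c))"

definition prod_charts ::
  "('a, 'e) chart set \<Rightarrow> ('b, 'f) chart set \<Rightarrow> ('a \<times> 'b, 'e \<times> 'f) chart set" where
  "prod_charts A B = (\<lambda>((U, c), (V, d)). (U \<times> V, map_prod c d)) ` (A \<times> B)"


section \<open>Lie groups\<close>

record ('a, 'e) lie_grp = "'a monoid" +
  gtop :: "'a topology"
  charts :: "('a, 'e) chart set"

definition lie_group :: "('a, 'e::euclidean_space) lie_grp \<Rightarrow> bool" where
  "lie_group G \<longleftrightarrow>
     group G \<and> topspace (gtop G) = carrier G \<and> smooth_manifold (gtop G) (charts G) \<and>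
     smooth_map (prod_topology (gtop G) (gtop G)) (prod_charts (charts G) (charts G))
       (gtop G) (charts G) (\<lambda>(x, y). x \<otimes>\<^bsub>G\<^esub> y) \<and>
     smooth_map (gtop G) (charts G) (gtop G) (charts G) (\<lambda>x. inv\<^bsub>G\<^esub> x)"

text \<open>Connected and simply connected: any two loops are homotopic through loops, as in
  \<^const>\<open>simply_connected\<close>, which the library only has for the type-class topology.\<close>

definition one_connected :: "'a topology \<Rightarrow> bool" where
  "one_connected X \<longleftrightarrow>
     connected_space X \<and>
     (\<forall>p q. pathin X p \<and> p 1 = p 0 \<and> pathin X q \<and> q 1 = q 0 \<longrightarrow>
        homotopic_with (\<lambda>r. r 1 = r 0) (top_of_set {0..1}) X p q)"

text \<open>Tangent vectors at the identity are given by their coordinates in a chart \<open>(U, c)\<close> around it.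
  \<open>left_field G (U, c) v\<close> is the left-invariant vector field with value \<open>v\<close> at the identity,
  written in that chart, and \<open>tangent_bracket\<close> is the value at the identity of
  \<open>[V, W] = DW(V) - DV(W)\<close>, the commutator of the vector fields as derivations.\<close>

definition left_field ::
  "('a, 'e::euclidean_space) lie_grp \<Rightarrow> ('a, 'e) chart \<Rightarrow> 'e \<Rightarrow> 'e \<Rightarrow> 'e" where
  "left_field G = (\<lambda>(U, c) v x.
     frechet_derivative (\<lambda>y. c (inv_into U c x \<otimes>\<^bsub>G\<^esub> inv_into U c y)) (at (c \<one>\<^bsub>G\<^esub>)) v)"

definition tangent_bracket ::
  "('a, 'e::euclidean_space) lie_grp \<Rightarrow> ('a, 'e) chart \<Rightarrow> 'e \<Rightarrow> 'e \<Rightarrow> 'e" where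
  "tangent_bracket G \<kappa> v w =
     frechet_derivative (left_field G \<kappa> w) (at (snd \<kappa> \<one>\<^bsub>G\<^esub>)) v
     - frechet_derivative (left_field G \<kappa> v) (at (snd \<kappa> \<one>\<^bsub>G\<^esub>)) w"

text \<open>\<open>\<iota>\<close> identifies the Lie algebra with bracket \<open>br\<close> with the Lie algebra of \<open>G\<close>, whose elements
  are written in the chart \<open>\<kappa>\<close> around the identity.\<close>

definition is_lie_algebra_of ::
  "('a, 'e::euclidean_space) lie_grp \<Rightarrow> ('a, 'e) chart \<Rightarrow> ('g::real_vector \<Rightarrow> 'e) \<Rightarrow>
     ('g \<Rightarrow> 'g \<Rightarrow> 'g) \<Rightarrow> bool" where
  "is_lie_algebra_of G \<kappa> \<iota> br \<longleftrightarrow>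
     \<kappa> \<in> charts G \<and> \<one>\<^bsub>G\<^esub> \<in> fst \<kappa> \<and> linear \<iota> \<and> bij \<iota> \<and>
     (\<forall>v w. \<iota> (br v w) = tangent_bracket G \<kappa> (\<iota> v) (\<iota> w))"


section \<open>The affine group of a Lie group on a vector space\<close>

text \<open>From here on \<open>H\<close> is a Lie group whose underlying manifold is the vector space \<open>'h\<close> itself, with
  the identity map as its only chart and with \<open>0\<close> as its identity element; in particular its Lie
  algebra, the tangent space at \<open>0\<close>, is again \<open>'h\<close>. Every 1-connected nilpotent Lie group has this
  form in exponential coordinates.\<close>

definition lie_automorphisms :: "('h::euclidean_space, 'h) lie_grp \<Rightarrow> ('h \<Rightarrow> 'h) set" where
  "lie_automorphisms H = {\<alpha> \<in> iso H H. smooth_on UNIV \<alpha> \<and> smooth_on UNIV (inv_into UNIV \<alpha>)}"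

definition aff_group :: "('h::euclidean_space, 'h) lie_grp \<Rightarrow> ('h \<times> ('h \<Rightarrow> 'h)) monoid" where
  "aff_group H =
     \<lparr>carrier = UNIV \<times> lie_automorphisms H,
      mult = (\<lambda>(h, \<alpha>) (k, \<beta>). (h \<otimes>\<^bsub>H\<^esub> \<alpha> k, \<alpha> \<circ> \<beta>)),
      one = (\<one>\<^bsub>H\<^esub>, id)\<rparr>"

definition aff_act :: "('h::euclidean_space, 'h) lie_grp \<Rightarrow> 'h \<times> ('h \<Rightarrow> 'h) \<Rightarrow> 'h \<Rightarrow> 'h" where
  "aff_act H = (\<lambda>(h, \<alpha>) x. h \<otimes>\<^bsub>H\<^esub> \<alpha> x)"

text \<open>For 1-connected \<open>H\<close>, sending an automorphism to its differential at the identity is an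
  isomorphism of \<open>Aut(H)\<close> onto the closed subgroup \<open>Aut(\<hh>)\<close> of \<open>GL(\<hh>)\<close>; this is what defines the
  smooth structure of \<open>Aut(H)\<close>. Hence \<open>aff_coord\<close> embeds \<open>Aff(H)\<close> as a submanifold of
  \<open>\<hh> \<times> End(\<hh>)\<close>, with tangent space \<open>\<hh> \<times> Der(\<hh>)\<close> at the identity.\<close>

definition aff_coord :: "'h::euclidean_space \<times> ('h \<Rightarrow> 'h) \<Rightarrow> 'h \<times> ('h \<Rightarrow>\<^sub>L 'h)" where
  "aff_coord = (\<lambda>(h, \<alpha>). (h, Blinfun (frechet_derivative \<alpha> (at 0))))"

definition smooth_hom_to_aff ::
  "('a, 'e::euclidean_space) lie_grp \<Rightarrow> ('h::euclidean_space, 'h) lie_grp \<Rightarrow>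
     ('a \<Rightarrow> 'h \<times> ('h \<Rightarrow> 'h)) \<Rightarrow> bool" where
  "smooth_hom_to_aff G H \<rho> \<longleftrightarrow>
     \<rho> \<in> hom G (aff_group H) \<and>
     (\<forall>(U, c)\<in>charts G. smooth_on (c ` U) (aff_coord \<circ> \<rho> \<circ> inv_into U c))"

definition differential_at_one ::
  "('a, 'e::euclidean_space) lie_grp \<Rightarrow> ('a, 'e) chart \<Rightarrow>
     ('a \<Rightarrow> 'h::euclidean_space \<times> ('h \<Rightarrow> 'h)) \<Rightarrow> 'e \<Rightarrow> 'h \<times> ('h \<Rightarrow>\<^sub>L 'h)" where
  "differential_at_one G = (\<lambda>(U, c) \<rho>.
     frechet_derivative (aff_coord \<circ> \<rho> \<circ> inv_into U c) (at (c \<one>\<^bsub>G\<^esub>)))"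

definition simply_transitive_on ::
  "('a, 'e) lie_grp \<Rightarrow> ('h::euclidean_space, 'h) lie_grp \<Rightarrow> ('a \<Rightarrow> 'h \<times> ('h \<Rightarrow> 'h)) \<Rightarrow> bool" where
  "simply_transitive_on G H \<rho> \<longleftrightarrow> (\<forall>x y. \<exists>!g. g \<in> carrier G \<and> aff_act H (\<rho> g) x = y)"

text \<open>\<open>brh\<close> is the bracket of the Lie algebra of \<open>H\<close>. The 1-connected Lie group \<open>G\<close> with Lie algebra
  \<open>brg\<close> and the morphism with differential \<open>\<phi>\<close> exist and are unique up to isomorphism, so
  the existential quantifiers pick out the group and the morphism. Dimensions agree under a simply
  transitive action, and a Lie group of positive dimension has the cardinality of the continuum, so
  no generality is lost by using \<open>'h\<close> both for the points of \<open>G\<close> (with an arbitrary topology) and for the values of its charts.\<close>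

definition simply_transitive_action ::
  "('g::real_vector \<Rightarrow> 'g \<Rightarrow> 'g) \<Rightarrow> ('h::euclidean_space, 'h) lie_grp \<Rightarrow> ('h \<Rightarrow> 'h \<Rightarrow> 'h) \<Rightarrow>
     ('g \<Rightarrow> 'h \<times> ('h \<Rightarrow>\<^sub>L 'h)) \<Rightarrow> bool" where
  "simply_transitive_action brg H brh \<phi> \<longleftrightarrow>
     aff_morphism brg brh \<phi> \<and>
     (\<exists>(G :: ('h, 'h) lie_grp) \<kappa> \<iota> \<rho>.
        lie_group G \<and> one_connected (gtop G) \<and> is_lie_algebra_of G \<kappa> \<iota> brg \<and>
        smooth_hom_to_aff G H \<rho> \<and> (\<forall>x. differential_at_one G \<kappa> \<rho> (\<iota> x) = \<phi> x) \<and>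
        simply_transitive_on G H \<rho>)"


section \<open>The 1-connected Lie group with Lie algebra \<open>\<nn>\<^sub>4\<close>\<close>

text \<open>The Baker-Campbell-Hausdorff product, which ends after the terms of order three because
  \<open>\<nn>\<^sub>4\<close> is nilpotent of class three.\<close>

definition N4_mult :: "real^4 \<Rightarrow> real^4 \<Rightarrow> real^4" where
  "N4_mult x y = x + y + (1/2) *\<^sub>R n4 x y + (1/12) *\<^sub>R n4 x (n4 x y) + (1/12) *\<^sub>R n4 y (n4 y x)"

definition N4 :: "(real^4, real^4) lie_grp" where
  "N4 = \<lparr>carrier = UNIV, mult = N4_mult, one = 0, gtop = euclidean, charts = {(UNIV, id)}\<rparr>"

text \<open>\<^const>\<open>N4\<close> is the 1-connected Lie group with Lie algebra \<^const>\<open>n4\<close>, in the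
  normalisation required of \<open>H\<close> above.\<close>

lemma differentiable_times_on_mono:
  "differentiable_times_on (Suc k) S f \<Longrightarrow> differentiable_times_on k S f"
proof (induction k arbitrary: f)
  case 0
  then show ?case
    by (simp add: differentiable_at_imp_differentiable_on differentiable_imp_continuous_on)
next
  case (Suc k)
  then show ?case by (metis differentiable_times_on.simps(2))
qed

lemma differentiable_times_on_const: "differentiable_times_on k UNIV (\<lambda>x. c)"
  by (induction k arbitrary: c) (auto simp: frechet_derivative_const)

lemma smooth_on_linear:
  assumes "bounded_linear f" shows "smooth_on UNIV f"
proof -
  have "differentiable_times_on k UNIV f" for k
  proof (cases k)
    case 0 then show ?thesis using assms by (simp add: linear_continuous_on)
  next
    case (Suc l)
    have "frechet_derivative f (at x) = f" for x
      using assms bounded_linear_imp_has_derivative frechet_derivative_at by metis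
    then show ?thesis
      using assms Suc differentiable_times_on_const
      by (auto simp: bounded_linear_imp_differentiable)
  qed
  then show ?thesis by (simp add: smooth_on_def)
qed

lemma differentiable_times_on_add:
  assumes "differentiable_times_on k UNIV f" "differentiable_times_on k UNIV g"
  shows "differentiable_times_on k UNIV (\<lambda>x. f x + g x)"
  using assms
proof (induction k arbitrary: f g)
  case 0 then show ?case by (auto intro: continuous_on_add)
next
  case (Suc k)
  have "((\<lambda>x. f x + g x) has_derivative
      (\<lambda>v. frechet_derivative f (at x) v + frechet_derivative g (at x) v)) (at x)" for x
    using Suc.prems by (auto intro!: has_derivative_add simp flip: frechet_derivative_works)
  then have "frechet_derivative (\<lambda>x. f x + g x) (at x)
      = (\<lambda>v. frechet_derivative f (at x) v + frechet_derivative g (at x) v)" for x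
    by (metis frechet_derivative_at)
  with Suc show ?case by (simp add: differentiable_add)
qed

lemma smooth_on_add:
  "smooth_on UNIV f \<Longrightarrow> smooth_on UNIV g \<Longrightarrow> smooth_on UNIV (\<lambda>x. f x + g x)"
  by (simp add: smooth_on_def differentiable_times_on_add)

lemma smooth_on_bilinear:
  fixes f :: "'a::euclidean_space \<Rightarrow> 'b::real_normed_vector" and g :: "'a \<Rightarrow> 'c::real_normed_vector"
  assumes b: "bounded_bilinear b" and "smooth_on UNIV f" "smooth_on UNIV g"
  shows "smooth_on UNIV (\<lambda>x. b (f x) (g x))"
proof -
  have "differentiable_times_on k UNIV (\<lambda>x. b (f x) (g x))"
    if "differentiable_times_on k UNIV f" "differentiable_times_on k UNIV g"
    for k and f :: "'a \<Rightarrow> 'b" and g :: "'a \<Rightarrow> 'c"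
    using that
  proof (induction k arbitrary: f g)
    case 0 then show ?case by (simp add: bounded_bilinear.continuous_on[OF b])
  next
    case (Suc k)
    have d: "((\<lambda>x. b (f x) (g x)) has_derivative (\<lambda>v. b (f x) (frechet_derivative g (at x) v)
        + b (frechet_derivative f (at x) v) (g x))) (at x)" for x
      using Suc.prems by (auto intro!: bounded_bilinear.FDERIV[OF b] simp flip: frechet_derivative_works)
    note eq = frechet_derivative_at[OF d, symmetric]
    have fg: "differentiable_times_on k UNIV f" "differentiable_times_on k UNIV g"
      using Suc.prems by (blast intro: differentiable_times_on_mono)+
    have "(\<lambda>x. b (f x) (g x)) differentiable (at x)" for x
      using d differentiable_def by blast
    moreover have "differentiable_times_on k UNIV
        (\<lambda>x. frechet_derivative (\<lambda>x. b (f x) (g x)) (at x) v)" for v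
      unfolding eq
      using Suc.prems by (intro differentiable_times_on_add Suc.IH fg) simp_all
    ultimately show ?case by simp
  qed
  then show ?thesis using assms by (auto simp: smooth_on_def)
qed

lemma lie_group_one_chart:
  fixes G :: "('e::euclidean_space, 'e) lie_grp"
  assumes "group G" and G: "carrier G = UNIV" "gtop G = euclidean" "charts G = {(UNIV, id)}"
    and m: "smooth_on UNIV (\<lambda>(x, y). x \<otimes>\<^bsub>G\<^esub> y)" and i: "smooth_on UNIV (\<lambda>x. inv\<^bsub>G\<^esub> x)"
  shows "lie_group G" and "one_connected (gtop G)"
proof -
  have cont: "continuous_on UNIV f" if "smooth_on UNIV f" for f :: "'a::euclidean_space \<Rightarrow> 'e"
    using that by (metis smooth_on_def differentiable_times_on.simps(1))
  have sec: "second_countable (euclidean :: 'e topology)"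
    unfolding second_countable_def
    by (smt (verit) ex_countable_basis topological_basisE open_openin topological_basis_open)
  have pc: "prod_charts (charts G) (charts G) = {(UNIV, id)}"
    by (simp add: prod_charts_def G map_prod.id)
  have pt: "prod_topology (gtop G) (gtop G) = euclidean"
    by (simp add: G prod_topology_euclidean)
  have "smooth_on UNIV (id :: 'e \<Rightarrow> 'e)"
    by (simp add: id_def smooth_on_linear)
  then have man: "smooth_manifold (gtop G) (charts G)"
    using sec by (simp add: smooth_manifold_def G)
  have map: "smooth_map euclidean {(UNIV, id)} (gtop G) (charts G) f"
    if "smooth_on UNIV f" for f :: "'a::euclidean_space \<Rightarrow> 'e"
    using that cont[OF that] by (simp add: smooth_map_def G)
  show "lie_group G"
    using \<open>group G\<close> man map[OF m] map[OF i] unfolding lie_group_def pc pt by (simp add: G)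
  have "connected_space (euclidean :: 'e topology)"
    by (metis connectedin_iff_connected connectedin_topspace connected_UNIV topspace_euclidean)
  moreover have "simply_connected (UNIV :: 'e set)"
    by (simp add: convex_imp_simply_connected)
  ultimately show "one_connected (gtop G)"
    unfolding G one_connected_def simply_connected_def homotopic_loops_def
    by (simp add: pathin_def path_def pathstart_def pathfinish_def)
qed

lemma n4_nth:
  "n4 x y $ 1 = 0" "n4 x y $ 2 = 0" "n4 x y $ 3 = cf x y 1 2" "n4 x y $ 4 = cf x y 1 3"
  by (simp_all add: n4_def axis_def)

lemma bounded_bilinear_n4: "bounded_bilinear n4"
  unfolding bilinear_conv_bounded_bilinear[symmetric] bilinear_def
  by (auto intro!: linearI simp: vec_eq_iff forall_4 n4_nth cf_def algebra_simps)

lemma n4_zero: "n4 0 y = 0" "n4 x 0 = 0"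
  using bounded_bilinear_n4 bounded_bilinear.zero_left bounded_bilinear.zero_right by blast+

lemma group_N4: "group N4"
proof (rule groupI)
  show "x \<otimes>\<^bsub>N4\<^esub> y \<otimes>\<^bsub>N4\<^esub> z = x \<otimes>\<^bsub>N4\<^esub> (y \<otimes>\<^bsub>N4\<^esub> z)" for x y z
    by (simp add: N4_def N4_mult_def vec_eq_iff forall_4 n4_nth cf_def field_simps)
next
  have "- x \<otimes>\<^bsub>N4\<^esub> x = \<one>\<^bsub>N4\<^esub>" for x
    by (simp add: N4_def N4_mult_def vec_eq_iff forall_4 n4_nth cf_def algebra_simps)
  then show "\<exists>y\<in>carrier N4. y \<otimes>\<^bsub>N4\<^esub> x = \<one>\<^bsub>N4\<^esub>" for x
    by (intro bexI[of _ "- x"]) (simp_all add: N4_def)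
qed (auto simp: N4_def N4_mult_def n4_zero)

lemma inv_N4: "inv\<^bsub>N4\<^esub> x = - x"
proof (rule group.inv_equality[OF group_N4])
  show "- x \<otimes>\<^bsub>N4\<^esub> x = \<one>\<^bsub>N4\<^esub>"
    by (simp add: N4_def N4_mult_def vec_eq_iff forall_4 n4_nth cf_def algebra_simps)
qed (simp_all add: N4_def)

lemma lie_group_N4: "lie_group N4" and one_connected_N4: "one_connected (gtop N4)"
proof -
  note b = smooth_on_bilinear[OF bounded_bilinear_n4]
  note l = smooth_on_linear
  have x: "smooth_on UNIV (fst :: (real^4) \<times> (real^4) \<Rightarrow> _)"
    and y: "smooth_on UNIV (snd :: (real^4) \<times> (real^4) \<Rightarrow> _)"
    by (simp_all add: l bounded_linear_fst bounded_linear_snd)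
  have sc: "smooth_on UNIV (\<lambda>p::(real^4) \<times> (real^4). c *\<^sub>R f p)" if "smooth_on UNIV f"
    for c and f :: "_ \<Rightarrow> real^4"
    using smooth_on_bilinear[OF bounded_bilinear_scaleR _ that] differentiable_times_on_const
    by (auto simp: smooth_on_def)
  have m: "smooth_on UNIV (\<lambda>(x, y). x \<otimes>\<^bsub>N4\<^esub> y)"
    by (simp add: N4_def N4_mult_def case_prod_beta') (intro smooth_on_add sc b x y)
  have i: "smooth_on UNIV (\<lambda>x. inv\<^bsub>N4\<^esub> x)"
    by (simp add: inv_N4 l bounded_linear_minus[OF bounded_linear_ident])
  show "lie_group N4" "one_connected (gtop N4)"
    by (rule lie_group_one_chart[OF group_N4 _ _ _ m i]; simp add: N4_def)+
qed

lemma is_lie_algebra_of_N4: "is_lie_algebra_of N4 (UNIV, id) id n4"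
proof -
  have [simp]: "inv_into UNIV id x = x" for x :: "real^4"
    using inv_into_f_f[of id UNIV x] by simp
  interpret n4: bounded_bilinear n4 by (rule bounded_bilinear_n4)
  have "(N4_mult x has_derivative (\<lambda>v. v + (1/2) *\<^sub>R n4 x v + (1/12) *\<^sub>R n4 x (n4 x v))) (at 0)" for x
    unfolding N4_mult_def
    by (rule derivative_eq_intros n4.FDERIV refl | simp add: n4_zero)+
  note d = frechet_derivative_at[OF this, symmetric]
  have left: "left_field N4 (UNIV, id) v
      = (\<lambda>x. v + (1/2) *\<^sub>R n4 x v + (1/12) *\<^sub>R n4 x (n4 x v))" for v
    by (simp add: left_field_def N4_def fun_eq_iff d)
  have "(left_field N4 (UNIV, id) v has_derivative (\<lambda>w. (1/2) *\<^sub>R n4 w v)) (at 0)" for v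
    unfolding left
    by (rule derivative_eq_intros n4.FDERIV refl | simp add: n4_zero)+
  note d' = frechet_derivative_at[OF this, symmetric]
  have "tangent_bracket N4 (UNIV, id) v w = (1/2) *\<^sub>R n4 v w - (1/2) *\<^sub>R n4 w v" for v w
  proof -
    have "snd (UNIV :: (real^4) set, id) \<one>\<^bsub>N4\<^esub> = (0 :: real^4)" by (simp add: N4_def)
    then show ?thesis by (simp only: tangent_bracket_def d')
  qed
  also have "(1/2) *\<^sub>R n4 v w - (1/2) *\<^sub>R n4 w v = n4 v w" for v w
    by (simp add: vec_eq_iff forall_4 n4_nth cf_def algebra_simps)
  finally show ?thesis
    by (simp add: is_lie_algebra_of_def N4_def linear_id)
qed

end

theory Submission
  imports Defs
begin

text \<open>
  Let \<open>\<phi> x = (t x, D x)\<close> be the differential of a simply transitive action. All orbit maps are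
  immersions (a singular one would have a negligible image by Sard's theorem), so \<open>t\<close> stays injective
  when \<open>\<phi>\<close> is conjugated by a translation. Derivations of \<open>n4\<close> are lower triangular with diagonal
  \<open>(a, k, a + k, 2 a + k)\<close>. Unless \<open>D e\<^sub>1\<close> is nilpotent, a translation achieves \<open>D e\<^sub>1 (t e\<^sub>1) = 0\<close>, and
  comparing \<open>ad e\<^sub>1\<close> with the triangular map \<open>D e\<^sub>1 + ad (t e\<^sub>1)\<close> shows that every eigenvalue of
  \<open>ad e\<^sub>1\<close>, including \<open>0\<close>, is one of these four numbers, that no complex eigenvalue occurs, that the
  centralizer of \<open>e\<^sub>1\<close> is its span, and that a Jordan block needs a repeated diagonal entry. This
  leaves the five algebras of the theorem, each of which acts by an explicit formula.
\<close>

text \<open>In \<open>t (br e v) = n4 (t e) (t v) + D e (t v) - D v (t e)\<close> the last term is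
  the obstacle: without it, \<open>t\<close> would embed \<open>ad e\<close> into the triangular map
  \<open>D e + ad (t e)\<close>. Once \<open>t e\<close> lies in the kernel of \<open>D e\<close>,
  the vector \<open>D v (t e)\<close> satisfies the same eigenvector equation for \<open>D e\<close>
  as \<open>v\<close> does for \<open>ad e\<close>, and this controls it. The price is that
  \<open>t\<close> must remain injective at the new base point, which is why immersivity is needed
  along every orbit map and not only at the identity.

  Translations do not change \<open>D\<close>, so its diagonal is fixed before normalizing. Two of
  \<open>a, k, a + k, 2 * a + k\<close> vanish only if all do; hence outside the nilpotent case the
  kernel of \<open>D e\<close> is at most a line. Since \<open>e\<close> itself has eigenvalue 0,
  exactly one entry vanishes, and the diagonal is determined up to scale in each of four cases.
  Matching it against the spectrum of \<open>ad e\<close> leaves finitely many parameters.\<close>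

definition vec4 :: "real \<Rightarrow> real \<Rightarrow> real \<Rightarrow> real \<Rightarrow> real^4" where
  "vec4 x1 x2 x3 x4 = (\<chi> i. if i = 1 then x1 else if i = 2 then x2 else if i = 3 then x3 else x4)"

lemma vec4_nth [simp]:
  "vec4 x1 x2 x3 x4 $ 1 = x1" "vec4 x1 x2 x3 x4 $ 2 = x2"
  "vec4 x1 x2 x3 x4 $ 3 = x3" "vec4 x1 x2 x3 x4 $ 4 = x4"
  by (simp_all add: vec4_def)

section \<open>Derivations of \<open>n4\<close> and lower triangular maps\<close>

definition n4_der :: "real \<Rightarrow> real \<Rightarrow> real \<Rightarrow> real \<Rightarrow> real \<Rightarrow> real \<Rightarrow> real \<Rightarrow> real^4 \<Rightarrow> real^4" where
  "n4_der a k b c d f g p = vec4 (a * p$1) (b * p$1 + k * p$2) (c * p$1 + f * p$2 + (a + k) * p$3)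
     (d * p$1 + g * p$2 + f * p$3 + (2 * a + k) * p$4)"

lemma n4_der_nth [simp]:
  "n4_der a k b c d f g p $ 1 = a * p$1"
  "n4_der a k b c d f g p $ 2 = b * p$1 + k * p$2"
  "n4_der a k b c d f g p $ 3 = c * p$1 + f * p$2 + (a + k) * p$3"
  "n4_der a k b c d f g p $ 4 = d * p$1 + g * p$2 + f * p$3 + (2 * a + k) * p$4"
  by (simp_all add: n4_der_def)

lemmas vec4_simps = vec_eq_iff forall_4 n4_nth cf_def

lemma vec4_expand: "(x :: real^4) = x$1 *\<^sub>R ee 1 + x$2 *\<^sub>R ee 2 + x$3 *\<^sub>R ee 3 + x$4 *\<^sub>R ee 4"
  by (simp add: vec_eq_iff forall_4 axis_def)

text \<open>\<open>ee 1\<close> and \<open>ee 2\<close> generate \<open>n4\<close>, so their images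
  determine \<open>D\<close>. The relation \<open>n4 (ee 2) (ee 3) = 0\<close> kills the first
  coordinate of \<open>D (ee 2)\<close>, which makes \<open>D\<close> triangular.\<close>

lemma linear_derivation_n4E:
  assumes lin: "linear D" and der: "\<And>x y. D (n4 x y) = n4 (D x) y + n4 x (D y)"
  obtains a k b c d f g where "D = n4_der a k b c d f g"
proof -
  have n: "n4 (ee 1) (ee 2) = ee 3" "n4 (ee 1) (ee 3) = ee 4" "n4 (ee 2) (ee 3) = 0"
    by (simp_all add: vec4_simps axis_def)
  have e3: "D (ee 3) = n4 (D (ee 1)) (ee 2) + n4 (ee 1) (D (ee 2))"
    and e4: "D (ee 4) = n4 (D (ee 1)) (ee 3) + n4 (ee 1) (D (ee 3))"
    and e0: "0 = n4 (D (ee 2)) (ee 3) + n4 (ee 2) (D (ee 3))"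
    using der[of "ee 1" "ee 2"] der[of "ee 1" "ee 3"] der[of "ee 2" "ee 3"] linear_0[OF lin]
    by (simp_all add: n)
  have D3: "D (ee 3) $ 1 = 0" "D (ee 3) $ 2 = 0" "D (ee 3) $ 3 = D (ee 1) $ 1 + D (ee 2) $ 2"
    "D (ee 3) $ 4 = D (ee 2) $ 3"
    using e3 by (auto simp: vec4_simps axis_def)
  have D4: "D (ee 4) $ 1 = 0" "D (ee 4) $ 2 = 0" "D (ee 4) $ 3 = 0"
    "D (ee 4) $ 4 = 2 * D (ee 1) $ 1 + D (ee 2) $ 2"
    using e4 D3 by (auto simp: vec4_simps axis_def)
  have D2: "D (ee 2) $ 1 = 0"
    using e0 D3 by (auto simp: vec4_simps axis_def)
  have "D p = n4_der (D (ee 1) $ 1) (D (ee 2) $ 2) (D (ee 1) $ 2) (D (ee 1) $ 3) (D (ee 1) $ 4)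
     (D (ee 2) $ 3) (D (ee 2) $ 4) p" for p
  proof -
    have "D p = p$1 *\<^sub>R D (ee 1) + p$2 *\<^sub>R D (ee 2) + p$3 *\<^sub>R D (ee 3) + p$4 *\<^sub>R D (ee 4)"
      by (subst vec4_expand[of p]) (simp add: linear_add[OF lin] linear_cmul[OF lin])
    then show ?thesis by (simp add: vec4_simps D2 D3 D4 algebra_simps)
  qed
  then show ?thesis using that by blast
qed

text \<open>Phrased along the flag of vectors with leading zeros instead of through a matrix:
  eigenvector arguments annihilate the coordinates one after another and use exactly these four
  clauses.\<close>

definition lower_triangular4 :: "(real^4 \<Rightarrow> real^4) \<Rightarrow> real \<Rightarrow> real \<Rightarrow> real \<Rightarrow> real \<Rightarrow> bool" where
  "lower_triangular4 M c1 c2 c3 c4 \<longleftrightarrow> (\<forall>x. M x $ 1 = c1 * x$1 \<and> (x$1 = 0 \<longrightarrow> M x $ 2 = c2 * x$2) \<and>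
     (x$1 = 0 \<and> x$2 = 0 \<longrightarrow> M x $ 3 = c3 * x$3) \<and>
     (x$1 = 0 \<and> x$2 = 0 \<and> x$3 = 0 \<longrightarrow> M x $ 4 = c4 * x$4))"

text \<open>\<open>n4 \<tau>\<close> is strictly lower triangular, so adding it leaves the diagonal
  alone.\<close>

lemma lower_triangular4_n4_der:
  "lower_triangular4 (n4_der a k b c d f g) a k (a + k) (2 * a + k)"
  "lower_triangular4 (\<lambda>x. n4 \<tau> x + n4_der a k b c d f g x) a k (a + k) (2 * a + k)"
  by (simp_all add: lower_triangular4_def n4_nth cf_def)

lemma lower_triangular4_eigenvector:
  assumes "lower_triangular4 M c1 c2 c3 c4" "M x = l *\<^sub>R x" "l \<notin> {c1, c2, c3, c4}"
  shows "x = 0"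
proof -
  note M = assms(1)[unfolded lower_triangular4_def, rule_format, of x, unfolded assms(2)]
  have x1: "x$1 = 0" using M assms(3) by auto
  have x2: "x$2 = 0" using M x1 assms(3) by auto
  have x3: "x$3 = 0" using M x1 x2 assms(3) by auto
  have "x$4 = 0" using M x1 x2 x3 assms(3) by auto
  with x1 x2 x3 show ?thesis by (simp add: vec_eq_iff forall_4)
qed

text \<open>\<open>x + i y\<close> would be an eigenvector for \<open>l + i\<close>, which is never
  one of the real diagonal entries; in each coordinate the resulting real system has determinant
  \<open>1 + (l - c)^2\<close>.\<close>

lemma lower_triangular4_no_complex_eigenvalue:
  assumes M: "lower_triangular4 M c1 c2 c3 c4" and x: "M x = l *\<^sub>R x - y" and y: "M y = x + l *\<^sub>R y"
  shows "x = 0 \<and> y = 0"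
proof -
  have z: "s = 0 \<and> t = 0" if "l * s - t = c * s" "s + l * t = c * t" for c s t :: real
  proof -
    have "t * (1 + (l - c)^2) = 0" using that by algebra
    then have "t = 0" by (simp add: add_nonneg_eq_0_iff)
    then show ?thesis using that by simp
  qed
  note X = M[unfolded lower_triangular4_def, rule_format, of x, unfolded x]
  note Y = M[unfolded lower_triangular4_def, rule_format, of y, unfolded y]
  have 1: "x$1 = 0 \<and> y$1 = 0"
    using X Y by (intro z[where c=c1]) (simp_all only: vector_add_component vector_minus_component vector_scaleR_component real_scaleR_def)
  have 2: "x$2 = 0 \<and> y$2 = 0"
    using 1 X Y by (intro z[where c=c2]) (simp_all only: vector_add_component vector_minus_component vector_scaleR_component real_scaleR_def)
  have 3: "x$3 = 0 \<and> y$3 = 0"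
    using 1 2 X Y by (intro z[where c=c3]) (simp_all only: vector_add_component vector_minus_component vector_scaleR_component real_scaleR_def)
  have "x$4 = 0 \<and> y$4 = 0"
    using 1 2 3 X Y by (intro z[where c=c4]) (simp_all only: vector_add_component vector_minus_component vector_scaleR_component real_scaleR_def)
  then show ?thesis using 1 2 3 by (simp add: vec_eq_iff forall_4)
qed

section \<open>Infinitesimal affine actions and change of base point\<close>

text \<open>The pairs \<open>(t x, D x)\<close> form a homomorphism into the affine Lie algebra of \<open>n4\<close>.\<close>

locale n4_rep =
  fixes br :: "'g::real_vector \<Rightarrow> 'g \<Rightarrow> 'g" and t :: "'g \<Rightarrow> real^4" and D :: "'g \<Rightarrow> real^4 \<Rightarrow> real^4"
  assumes linear_t: "linear t" and linear_D: "linear (\<lambda>x. D x p)"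
    and linear_D_apply: "linear (D x)"
    and D_n4: "D x (n4 p q) = n4 (D x p) q + n4 p (D x q)"
    and t_br: "t (br x y) = n4 (t x) (t y) + D x (t y) - D y (t x)"
    and D_br: "D (br x y) p = D x (D y p) - D y (D x p)"
begin

lemma D_n4_derE:
  obtains a k b c d f g where "D x = n4_der a k b c d f g"
  using linear_derivation_n4E[of "D x"] linear_D_apply D_n4 by metis

end

text \<open>In exponential coordinates on the group the vector field of the infinitesimal affine
  transformation \<open>(\<tau>, E)\<close> is \<open>p \<mapsto> \<tau> + E p + [\<tau>, p]/2 + [p, [p, \<tau>]]/12\<close>.\<close>

definition aff_field :: "real^4 \<Rightarrow> (real^4 \<Rightarrow> real^4) \<Rightarrow> real^4 \<Rightarrow> real^4" where
  "aff_field \<tau> E p = \<tau> + E p + (1/2) *\<^sub>R n4 \<tau> p + (1/12) *\<^sub>R n4 p (n4 p \<tau>)"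

text \<open>\<open>exp (- ad (p, 0))\<close> moves the base point from \<open>0\<close> to \<open>p\<close>.\<close>

definition base_change :: "real^4 \<Rightarrow> real^4 \<Rightarrow> (real^4 \<Rightarrow> real^4) \<Rightarrow> real^4" where
  "base_change p \<tau> E = (let w = n4 p \<tau> - E p in
     \<tau> - w + (1/2) *\<^sub>R n4 p w - (1/6) *\<^sub>R n4 p (n4 p w))"

lemma n4_nilpotent: "n4 p (n4 q (n4 x y)) = 0"
  by (simp add: vec4_simps)

text \<open>The map applied to \<open>u\<close> is the differential at 0 of left translation by
  \<open>p\<close>. So the field at \<open>p\<close> is the left translate of the velocity at the
  identity of the conjugated action.\<close>

lemma aff_field_base_change:
  "aff_field \<tau> E p = (let u = base_change p \<tau> E in u + (1/2) *\<^sub>R n4 p u + (1/12) *\<^sub>R n4 p (n4 p u))"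
proof -
  interpret n4: bounded_bilinear n4 by (rule bounded_bilinear_n4)
  have "n4 \<tau> p = - n4 p \<tau>" by (simp add: vec4_simps)
  then show ?thesis
    by (simp add: aff_field_def base_change_def Let_def n4.add_right n4.diff_right n4.scaleR_right
        n4_nilpotent scaleR_diff_right scaleR_add_right)
      (simp add: vec_eq_iff field_simps)
qed

lemma base_change_eq_0: "base_change p \<tau> E = 0 \<Longrightarrow> aff_field \<tau> E p = 0"
  by (simp add: aff_field_base_change n4_zero)

lemma (in n4_rep) linear_base_change: "linear (\<lambda>x. base_change p (t x) (D x))"
proof -
  interpret n4: bounded_bilinear n4 by (rule bounded_bilinear_n4)
  have lin: "linear (\<lambda>x. n4 p (h x))" if "linear h" for h :: "'g \<Rightarrow> real^4"
    using linear_compose[OF that bounded_linear.linear[OF n4.bounded_linear_right]] by (simp add: o_def)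
  show ?thesis
    unfolding base_change_def Let_def
    using linear_t linear_D by (auto intro!: linear_compose_add linear_compose_sub linear_compose_scale_right lin)
qed

text \<open>The substitution \<open>p = 6 q\<close> clears all denominators.\<close>

lemma base_change_integral:
  assumes "linear E"
  shows "base_change (6 *\<^sub>R q) \<tau> E = (let w = n4 q \<tau> - E q in
     \<tau> - 6 *\<^sub>R w + 18 *\<^sub>R n4 q w - 36 *\<^sub>R n4 q (n4 q w))"
proof -
  interpret n4: bounded_bilinear n4 by (rule bounded_bilinear_n4)
  show ?thesis
    unfolding Let_def base_change_def
    by (simp add: linear_cmul[OF assms] n4.scaleR_left n4.scaleR_right n4.diff_right scaleR_diff_right)
qed

text \<open>The bracket of \<open>(p, 0)\<close> with \<open>(\<tau>, E)\<close> has linear part 0,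
  so the automorphism \<open>exp (- ad (p, 0))\<close> of the affine Lie algebra moves
  \<open>t\<close> and keeps \<open>D\<close>. The homomorphism property is checked as a polynomial
  identity in coordinates.\<close>

lemma (in n4_rep) n4_rep_base_change: "n4_rep br (\<lambda>x. base_change p (t x) (D x)) D"
proof (rule n4_rep.intro)
  show "base_change p (t (br x y)) (D (br x y)) =
    n4 (base_change p (t x) (D x)) (base_change p (t y) (D y)) +
    D x (base_change p (t y) (D y)) - D y (base_change p (t x) (D x))" for x y
  proof -
    obtain a k b c d f g where x: "D x = n4_der a k b c d f g" by (rule D_n4_derE)
    obtain a' k' b' c' d' f' g' where y: "D y = n4_der a' k' b' c' d' f' g'" by (rule D_n4_derE)
    define q where "q = (1/6) *\<^sub>R p"
    have p: "p = 6 *\<^sub>R q" by (simp add: q_def)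
    show ?thesis
      unfolding p base_change_integral[OF linear_D_apply] Let_def D_br t_br
      unfolding x y vec4_simps vector_add_component vector_minus_component vector_scaleR_component n4_der_nth real_scaleR_def
      apply (intro conjI)
      subgoal by algebra
      subgoal by algebra
      subgoal by algebra
      subgoal by algebra
      done
  qed
qed (fact linear_base_change linear_D linear_D_apply D_n4 D_br)+

text \<open>The rows of \<open>E u = 0\<close> are solved from the top, row \<open>i\<close> for the
  coordinate \<open>p_i\<close>. A row whose diagonal entry is 0 cannot be adjusted, but then all
  earlier diagonal entries are nonzero, so the earlier rows have made the earlier coordinates of
  \<open>u\<close> vanish and the row holds by itself.\<close>

lemma base_change_kernel:
  assumes E: "E = n4_der a k b c d f g" and nz: "a \<noteq> 0 \<or> k \<noteq> 0"
  shows "\<exists>p. E (base_change p \<tau> E) = 0"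
proof -
  define u where "u p1 p2 p3 p4 = base_change (vec4 p1 p2 p3 p4) \<tau> E" for p1 p2 p3 p4
  have u1: "u p1 p2 p3 p4 $ 1 = \<tau>$1 + a * p1" for p1 p2 p3 p4
    by (simp add: u_def base_change_def Let_def E n4_nth)
  have u2: "u p1 p2 p3 p4 $ 2 = \<tau>$2 + b * p1 + k * p2" for p1 p2 p3 p4
    by (simp add: u_def base_change_def Let_def E n4_nth)
  have u3: "u p1 p2 p3 p4 $ 3 = u p1 p2 0 0 $ 3 + (a + k) * p3" for p1 p2 p3 p4
    by (simp add: u_def base_change_def Let_def E n4_nth cf_def algebra_simps)
  have u4: "u p1 p2 p3 p4 $ 4 = u p1 p2 p3 0 $ 4 + (2 * a + k) * p4" for p1 p2 p3 p4
    by (simp add: u_def base_change_def Let_def E n4_nth cf_def algebra_simps)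
  \<comment> \<open>\<open>p_i\<close> enters the \<open>i\<close>-th coordinate of \<open>u\<close>
    with the diagonal entry \<open>r\<close> of \<open>E\<close> as coefficient, and row
    \<open>i\<close> of \<open>E\<close> multiplies by \<open>r\<close> once more.\<close>
  have solve: "\<exists>x. s + r * (m + r * x) = 0" if "r = 0 \<Longrightarrow> s = 0" for s r m :: real
  proof (cases "r = 0")
    case False
    then have "s + r * (m + r * (- (m + s / r) / r)) = 0" by (simp add: field_simps)
    then show ?thesis by blast
  qed (use that in simp)
  obtain p1 where "0 + a * (\<tau>$1 + a * p1) = 0" using solve[of a 0] by auto
  then have 1: "a * u p1 p2 p3 p4 $ 1 = 0" for p2 p3 p4 by (simp add: u1)
  obtain p2 where "b * (\<tau>$1 + a * p1) + k * (\<tau>$2 + b * p1 + k * p2) = 0"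
    using solve[of k "b * (\<tau>$1 + a * p1)" "\<tau>$2 + b * p1"] 1 nz u1 by auto
  then have 2: "b * u p1 p2 p3 p4 $ 1 + k * u p1 p2 p3 p4 $ 2 = 0" for p3 p4 by (simp add: u1 u2)
  have "c * (\<tau>$1 + a * p1) + f * (\<tau>$2 + b * p1 + k * p2) = 0" if "a + k = 0"
  proof -
    have "a \<noteq> 0" "k \<noteq> 0" using that nz by auto
    then have "u p1 p2 0 0 $ 1 = 0" "u p1 p2 0 0 $ 2 = 0"
      using 1[of p2 0 0] 2[of 0 0] by auto
    then show ?thesis by (simp add: u1 u2)
  qed
  then obtain p3 where "c * (\<tau>$1 + a * p1) + f * (\<tau>$2 + b * p1 + k * p2) +
      (a + k) * (u p1 p2 0 0 $ 3 + (a + k) * p3) = 0"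
    using solve[of "a + k"] by blast
  then have 3: "c * u p1 p2 p3 p4 $ 1 + f * u p1 p2 p3 p4 $ 2 + (a + k) * u p1 p2 p3 p4 $ 3 = 0" for p4
    using u3[of p1 p2 p3 p4] by (simp add: u1 u2)
  have "d * (\<tau>$1 + a * p1) + g * (\<tau>$2 + b * p1 + k * p2) + f * (u p1 p2 p3 0 $ 3) = 0" if "2 * a + k = 0"
  proof -
    have "a \<noteq> 0" "k \<noteq> 0" "a + k \<noteq> 0" using that nz by auto
    then have "u p1 p2 p3 0 $ 1 = 0" "u p1 p2 p3 0 $ 2 = 0" "u p1 p2 p3 0 $ 3 = 0"
      using 1[of p2 p3 0] 2[of p3 0] 3[of 0] by auto
    then show ?thesis by (simp add: u1 u2)
  qed
  then obtain p4 where "d * (\<tau>$1 + a * p1) + g * (\<tau>$2 + b * p1 + k * p2) + f * (u p1 p2 p3 0 $ 3) +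
      (2 * a + k) * (u p1 p2 p3 0 $ 4 + (2 * a + k) * p4) = 0"
    using solve[of "2 * a + k"] by blast
  then have 4: "d * u p1 p2 p3 p4 $ 1 + g * u p1 p2 p3 p4 $ 2 + f * u p1 p2 p3 p4 $ 3 +
      (2 * a + k) * u p1 p2 p3 p4 $ 4 = 0"
    using u4[of p1 p2 p3 p4] u3[of p1 p2 p3 p4] u3[of p1 p2 p3 0] by (simp add: u1 u2)
  have "E (u p1 p2 p3 p4) = 0"
    using 1 2 3 4 by (simp add: E vec_eq_iff forall_4)
  then show ?thesis unfolding u_def by blast
qed

section \<open>Spectral constraints on \<open>ad e\<close>\<close>

locale n4_etale_rep = n4_rep +
  assumes etale: "x \<noteq> 0 \<Longrightarrow> aff_field (t x) (D x) p \<noteq> 0"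
begin

text \<open>Injectivity of \<open>t'\<close> is the assumption \<open>etale\<close> at the point
  \<open>p\<close> chosen for \<open>e\<close>.\<close>

lemma normalize:
  assumes "D e = n4_der a k b c d f g"
  shows "\<exists>t'. n4_rep br t' D \<and> (\<forall>x. x \<noteq> 0 \<longrightarrow> t' x \<noteq> 0) \<and> (a \<noteq> 0 \<or> k \<noteq> 0 \<longrightarrow> D e (t' e) = 0)"
proof -
  obtain p where p: "a \<noteq> 0 \<or> k \<noteq> 0 \<longrightarrow> D e (base_change p (t e) (D e)) = 0"
    using base_change_kernel[OF assms] by blast
  have "\<forall>x. x \<noteq> 0 \<longrightarrow> base_change p (t x) (D x) \<noteq> 0"
    using etale base_change_eq_0 by blast
  with p n4_rep_base_change[of p] show ?thesis
    by (intro exI[of _ "\<lambda>x. base_change p (t x) (D x)"]) simp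
qed

text \<open>If \<open>D e\<close> is nilpotent, then so is \<open>ad (D e)\<close>, and its eigenvector \<open>D v\<close> vanishes; otherwise
  \<open>D v\<close> maps the kernel vector \<open>t' e\<close> of \<open>D e\<close> to an \<open>l\<close>-eigenvector of \<open>D e\<close>.\<close>

lemma eigenvalue:
  assumes E: "D e = n4_der a k b c d f g" and v: "br e v = l *\<^sub>R v" "v \<noteq> 0"
  shows "l \<in> {a, k, a + k, 2 * a + k}"
proof (rule ccontr)
  assume l: "l \<notin> {a, k, a + k, 2 * a + k}"
  obtain t' where t': "n4_rep br t' D" "\<forall>x. x \<noteq> 0 \<longrightarrow> t' x \<noteq> 0"
    and ker: "a \<noteq> 0 \<or> k \<noteq> 0 \<longrightarrow> D e (t' e) = 0"
    using normalize[OF E] by blast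
  interpret t': n4_rep br t' D by (fact t'(1))
  have DV: "D e (D v p) - D v (D e p) = l *\<^sub>R D v p" for p
    using D_br[of e v p] by (simp add: v linear_cmul[OF linear_D])
  have "D v (t' e) = 0"
  proof (cases "a = 0 \<and> k = 0")
    case True
    obtain a' k' b' c' d' f' g' where V: "D v = n4_der a' k' b' c' d' f' g'" by (rule D_n4_derE)
    note B = DV[unfolded E V vec_eq_iff forall_4]
    have l0: "l \<noteq> 0" using l True by auto
    have 0: "a' = 0" "k' = 0" using B[of "ee 1"] B[of "ee 2"] True l0 by (auto simp: axis_def)
    then have 1: "b' = 0" "f' = 0" using B[of "ee 1"] B[of "ee 2"] True l0 by (auto simp: axis_def)
    then have 2: "c' = 0" "g' = 0" using 0 B[of "ee 1"] B[of "ee 2"] True l0 by (auto simp: axis_def)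
    then have "d' = 0" using 0 1 B[of "ee 1"] True l0 by (auto simp: axis_def)
    with 0 1 2 show ?thesis by (simp add: V vec_eq_iff forall_4)
  next
    case False
    then have "D e (t' e) = 0" using ker by blast
    then have "D e (D v (t' e)) = l *\<^sub>R D v (t' e)"
      using DV[of "t' e"] by (simp add: linear_0[OF linear_D_apply])
    then show ?thesis using lower_triangular4_eigenvector[OF lower_triangular4_n4_der(1)] E l by metis
  qed
  \<comment> \<open>With the term \<open>D v (t' e)\<close> gone, \<open>t' v\<close> is an
    eigenvector of a triangular map with the diagonal of \<open>D e\<close>.\<close>
  then have "n4 (t' e) (t' v) + D e (t' v) = l *\<^sub>R t' v"
    using t'.t_br[of e v] by (simp add: v linear_cmul[OF t'.linear_t])
  then have "t' v = 0"
    using lower_triangular4_eigenvector[OF lower_triangular4_n4_der(2)[of "t' e" a k b c d f g] _ l] E by simp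
  then show False using t'(2) v by blast
qed

text \<open>\<open>v + i w\<close> is an eigenvector of \<open>ad e\<close> for
  \<open>l + i\<close>; the argument for real eigenvalues applies to the pair \<open>v\<close>,
  \<open>w\<close>.\<close>

lemma no_complex_eigenvalue:
  assumes v: "br e v = l *\<^sub>R v - w" and w: "br e w = v + l *\<^sub>R w" and "v \<noteq> 0"
  shows False
proof -
  obtain a k b c d f g where E: "D e = n4_der a k b c d f g" by (rule D_n4_derE)
  obtain t' where t': "n4_rep br t' D" "\<forall>x. x \<noteq> 0 \<longrightarrow> t' x \<noteq> 0"
    and ker: "a \<noteq> 0 \<or> k \<noteq> 0 \<longrightarrow> D e (t' e) = 0"
    using normalize[OF E] by blast
  interpret t': n4_rep br t' D by (fact t'(1))
  have DV: "D e (D v p) - D v (D e p) = l *\<^sub>R D v p - D w p" for p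
    using D_br[of e v p] by (simp add: v linear_cmul[OF linear_D] linear_diff[OF linear_D])
  have DW: "D e (D w p) - D w (D e p) = D v p + l *\<^sub>R D w p" for p
    using D_br[of e w p] by (simp add: w linear_cmul[OF linear_D] linear_add[OF linear_D])
  have "D v (t' e) = 0 \<and> D w (t' e) = 0"
  proof (cases "a = 0 \<and> k = 0")
    case True
    obtain a1 k1 b1 c1 d1 f1 g1 where V: "D v = n4_der a1 k1 b1 c1 d1 f1 g1" by (rule D_n4_derE)
    obtain a2 k2 b2 c2 d2 f2 g2 where W: "D w = n4_der a2 k2 b2 c2 d2 f2 g2" by (rule D_n4_derE)
    have z: "s = 0 \<and> r = 0" if "l * s - r = 0" "s + l * r = 0" for s r :: real
    proof -
      have "r * (1 + l^2) = 0" using that by algebra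
      then have "r = 0" by (simp add: add_nonneg_eq_0_iff)
      then show ?thesis using that by simp
    qed
    note B = DV[unfolded E V W vec_eq_iff forall_4] DW[unfolded E V W vec_eq_iff forall_4]
    note B' = B[of "ee 1"] B[of "ee 2"]
    \<comment> \<open>Since \<open>D e\<close> is strictly triangular, its commutator with
      \<open>D v\<close> or \<open>D w\<close> involves at each matrix entry only entries closer to
      the diagonal. Working away from the diagonal, each pair of entries solves a system of
      determinant \<open>1 + l^2\<close>.\<close>
    have 0: "a1 = 0 \<and> a2 = 0" "k1 = 0 \<and> k2 = 0" using B' True by (intro z; simp add: axis_def)+
    then have 1: "b1 = 0 \<and> b2 = 0" "f1 = 0 \<and> f2 = 0" using B' True by (intro z; simp add: axis_def)+
    then have 2: "c1 = 0 \<and> c2 = 0" "g1 = 0 \<and> g2 = 0" using 0 B' True by (intro z; simp add: axis_def)+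
    then have "d1 = 0 \<and> d2 = 0" using 0 1 B' True by (intro z; simp add: axis_def)+
    with 0 1 2 show ?thesis by (simp add: V W vec_eq_iff forall_4)
  next
    case False
    then have "D e (t' e) = 0" using ker by blast
    then have "D e (D v (t' e)) = l *\<^sub>R D v (t' e) - D w (t' e)"
      "D e (D w (t' e)) = D v (t' e) + l *\<^sub>R D w (t' e)"
      using DV[of "t' e"] DW[of "t' e"] by (simp_all add: linear_0[OF linear_D_apply])
    then show ?thesis
      by (rule lower_triangular4_no_complex_eigenvalue[OF lower_triangular4_n4_der(1)[of a k b c d f g, folded E]])
  qed
  then have "n4 (t' e) (t' v) + D e (t' v) = l *\<^sub>R t' v - t' w"
    "n4 (t' e) (t' w) + D e (t' w) = t' v + l *\<^sub>R t' w"
    using t'.t_br[of e v] t'.t_br[of e w]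
    by (simp_all add: v w linear_cmul[OF t'.linear_t] linear_add[OF t'.linear_t] linear_diff[OF t'.linear_t])
  then have "t' v = 0 \<and> t' w = 0"
    by (rule lower_triangular4_no_complex_eigenvalue[OF lower_triangular4_n4_der(2)[of "t' e" a k b c d f g, folded E]])
  then show False using t'(2) assms by blast
qed

text \<open>\<open>e\<close> is its own eigenvector for the eigenvalue 0.\<close>

lemma zero_eigenvalue:
  assumes E: "D e = n4_der a k b c d f g" and e: "br e e = 0" "e \<noteq> 0"
  shows "a = 0 \<or> k = 0 \<or> a + k = 0 \<or> 2 * a + k = 0"
  using eigenvalue[OF E, of e 0] e by auto

text \<open>\<open>D v\<close> commutes with \<open>D e\<close>, so \<open>W\<close> stays in the
  kernel of \<open>D e\<close>, a line spanned by \<open>\<tau>\<close>. The row of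
  \<open>n4 \<tau> T + D e T = W\<close> with diagonal entry 0 kills the pivot coordinate of
  \<open>W\<close>, hence \<open>W\<close>. Then \<open>T\<close> and \<open>\<tau>\<close> both lie
  in the kernel of \<open>n4 \<tau> + D e\<close>, a line for the same reason.\<close>

lemma centralizer:
  assumes E: "D e = n4_der a k b c d f g" and nz: "a \<noteq> 0 \<or> k \<noteq> 0"
    and e: "br e e = 0" "e \<noteq> 0" and v: "br e v = 0"
  shows "\<exists>r. v = r *\<^sub>R e"
proof -
  obtain t' where t': "n4_rep br t' D" "\<forall>x. x \<noteq> 0 \<longrightarrow> t' x \<noteq> 0"
    and "a \<noteq> 0 \<or> k \<noteq> 0 \<longrightarrow> D e (t' e) = 0"
    using normalize[OF E] by blast
  then have ker: "D e (t' e) = 0" using nz by simp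
  interpret t': n4_rep br t' D by (fact t'(1))
  define \<tau> T W where "\<tau> = t' e" and "T = t' v" and "W = D v \<tau>"
  have DV: "D e (D v p) = D v (D e p)" for p
    using D_br[of e v p] by (simp add: v linear_0[OF linear_D])
  have "D e W = 0" using DV[of \<tau>] ker by (simp add: W_def \<tau>_def linear_0[OF linear_D_apply])
  note W = this[unfolded E vec_eq_iff forall_4 vector_add_component zero_index n4_nth cf_def n4_der_nth]
  note \<tau> = ker[folded \<tau>_def, unfolded E vec_eq_iff forall_4 vector_add_component zero_index n4_nth cf_def n4_der_nth]
  have "n4 \<tau> T + D e T = W"
    using t'.t_br[of e v] by (simp add: v linear_0[OF t'.linear_t] T_def W_def \<tau>_def)
  note T = this[unfolded E vec_eq_iff forall_4 vector_add_component zero_index n4_nth cf_def n4_der_nth]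
  have "\<tau> \<noteq> 0" using e t' by (simp add: \<tau>_def)
  then have \<tau>0: "\<tau>$1 \<noteq> 0 \<or> \<tau>$2 \<noteq> 0 \<or> \<tau>$3 \<noteq> 0 \<or> \<tau>$4 \<noteq> 0" by (auto simp: vec_eq_iff forall_4)
  have "\<exists>r s. s \<noteq> 0 \<and> s *\<^sub>R T = r *\<^sub>R \<tau>"
  proof -
    consider (1) "a = 0" "k \<noteq> 0" | (2) "k = 0" "a \<noteq> 0" | (3) "k = - a" "a \<noteq> 0" | (4) "k = - 2 * a" "a \<noteq> 0"
      using zero_eigenvalue[OF E e] nz by fastforce
    then show ?thesis
    proof cases
      case 1
      have W0: "W$1 = 0" using T 1 by simp
      then have "W$2 = 0" using W 1 by simp
      then have "W$3 = 0" using W 1 W0 by simp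
      then have "W$4 = 0" using W 1 W0 \<open>W$2 = 0\<close> by simp
      note W' = W0 \<open>W$2 = 0\<close> \<open>W$3 = 0\<close> this
      have "\<tau>$1 \<noteq> 0" using \<tau> \<tau>0 1 by auto
      \<comment> \<open>Proportionality is expressed by the 2 x 2 minors with the pivot
        \<open>\<tau>$1\<close>, each eliminated from one row of the two kernel equations.\<close>
      moreover have "k * (\<tau>$1 * T$2 - T$1 * \<tau>$2) = 0"
        using \<tau> T W' 1 by (simp add: n4_nth) algebra
      then have 2: "\<tau>$1 * T$2 = T$1 * \<tau>$2" using 1 by simp
      moreover have "k * (\<tau>$1 * T$3 - T$1 * \<tau>$3) = 0"
        using \<tau> T W' 1 2 by (simp add: n4_nth cf_def) algebra
      then have 3: "\<tau>$1 * T$3 = T$1 * \<tau>$3" using 1 by simp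
      moreover have "k * (\<tau>$1 * T$4 - T$1 * \<tau>$4) = 0"
        using \<tau> T W' 1 2 3 by (simp add: n4_nth cf_def) algebra
      then have "\<tau>$1 * T$4 = T$1 * \<tau>$4" using 1 by simp
      ultimately show ?thesis
        by (intro exI[of _ "T$1"] exI[of _ "\<tau>$1"]) (simp add: vec_eq_iff forall_4)
    next
      case 2
      have z: "\<tau>$1 = 0" "W$1 = 0" "T$1 = 0" using \<tau> W T 2 by (auto simp: n4_nth)
      then have W2: "W$2 = 0" using T 2 by (simp add: n4_nth)
      then have "W$3 = 0" using W 2 z by simp
      then have "W$4 = 0" using W 2 z W2 by simp
      note W' = W2 \<open>W$3 = 0\<close> this
      have "\<tau>$2 \<noteq> 0" using \<tau> \<tau>0 2 z by auto
      moreover have "a * (\<tau>$2 * T$3 - T$2 * \<tau>$3) = 0"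
        using \<tau> T W' 2 z by (simp add: n4_nth cf_def) algebra
      then have 3: "\<tau>$2 * T$3 = T$2 * \<tau>$3" using 2 by simp
      moreover have "2 * a * (\<tau>$2 * T$4 - T$2 * \<tau>$4) = 0"
        using \<tau> T W' 2 3 z by (simp add: n4_nth cf_def) algebra
      then have "\<tau>$2 * T$4 = T$2 * \<tau>$4" using 2 by simp
      ultimately show ?thesis using z
        by (intro exI[of _ "T$2"] exI[of _ "\<tau>$2"]) (simp add: vec_eq_iff forall_4)
    next
      case 3
      have z: "\<tau>$1 = 0" "W$1 = 0" "T$1 = 0" using \<tau> W T 3 by (auto simp: n4_nth)
      then have z2: "\<tau>$2 = 0" "W$2 = 0" "T$2 = 0" using \<tau> W T 3 by (auto simp: n4_nth)
      then have W3: "W$3 = 0" using T 3 z by (simp add: n4_nth cf_def)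
      then have "W$4 = 0" using W 3 z z2 by simp
      note W' = W3 this
      have "\<tau>$3 \<noteq> 0" using \<tau> \<tau>0 3 z z2 by auto
      moreover have "a * (\<tau>$3 * T$4 - T$3 * \<tau>$4) = 0"
        using \<tau> T W' 3 z z2 by (simp add: n4_nth cf_def) algebra
      then have "\<tau>$3 * T$4 = T$3 * \<tau>$4" using 3 by simp
      ultimately show ?thesis using z z2
        by (intro exI[of _ "T$3"] exI[of _ "\<tau>$3"]) (simp add: vec_eq_iff forall_4)
    next
      case 4
      have z: "\<tau>$1 = 0" "W$1 = 0" "T$1 = 0" using \<tau> W T 4 by (auto simp: n4_nth)
      then have z2: "\<tau>$2 = 0" "W$2 = 0" "T$2 = 0" using \<tau> W T 4 by (auto simp: n4_nth)
      then have z3: "\<tau>$3 = 0" "W$3 = 0" "T$3 = 0" using \<tau> W T 4 z by (auto simp: n4_nth cf_def)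
      then show ?thesis using z z2 \<tau>0
        by (intro exI[of _ "T$4"] exI[of _ "\<tau>$4"]) (simp add: vec_eq_iff forall_4)
    qed
  qed
  then obtain r s where "s \<noteq> 0" "t' (s *\<^sub>R v - r *\<^sub>R e) = 0"
    by (auto simp: T_def \<tau>_def linear_diff[OF t'.linear_t] linear_cmul[OF t'.linear_t])
  then have "s *\<^sub>R v = r *\<^sub>R e" using t'(2) by (metis eq_iff_diff_eq_0)
  then have "v = (r / s) *\<^sub>R e" using \<open>s \<noteq> 0\<close>
    by (metis divide_inverse_commute real_vector.scale_left_imp_eq scaleR_scaleR right_inverse scaleR_one)
  then show ?thesis ..
qed

end

context n4_etale_rep
begin

text \<open>If \<open>l\<close> occurs once on the diagonal, then in that row of the equation for
  \<open>T2\<close> the \<open>l\<close>-terms cancel, leaving the pivot coordinate of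
  \<open>T1\<close> up to \<open>W2\<close>. When \<open>W2\<close> does not interfere,
  \<open>T1\<close> is an eigenvector without pivot, so 0.\<close>

lemma jordan_block:
  assumes E: "D e = n4_der a k b c d f g" and nz: "a \<noteq> 0 \<or> k \<noteq> 0"
    and e: "br e e = 0" "e \<noteq> 0" and v: "br e v = l *\<^sub>R v" and w: "br e w = v + l *\<^sub>R w"
    and l: "l \<noteq> 0" and "v \<noteq> 0" and indep: "\<And>r. w \<noteq> r *\<^sub>R v"
  shows "a = 0 \<and> l = k \<or> k = 0 \<and> l = a \<or> k = - a \<and> l = a"
proof (rule ccontr)
  assume not: "\<not> ?thesis"
  obtain t' where t': "n4_rep br t' D" "\<forall>x. x \<noteq> 0 \<longrightarrow> t' x \<noteq> 0"
    and "a \<noteq> 0 \<or> k \<noteq> 0 \<longrightarrow> D e (t' e) = 0"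
    using normalize[OF E] by blast
  then have ker: "D e (t' e) = 0" using nz by simp
  interpret t': n4_rep br t' D by (fact t'(1))
  define \<tau> T1 T2 W1 W2 where "\<tau> = t' e" and "T1 = t' v" and "T2 = t' w"
    and "W1 = D v \<tau>" and "W2 = D w \<tau>"
  have DV: "D e (D v p) - D v (D e p) = l *\<^sub>R D v p" for p
    using D_br[of e v p] by (simp add: v linear_cmul[OF linear_D])
  have DW: "D e (D w p) - D w (D e p) = D v p + l *\<^sub>R D w p" for p
    using D_br[of e w p] by (simp add: w linear_cmul[OF linear_D] linear_add[OF linear_D])
  obtain a' k' b' c' d' f' g' where X: "D w = n4_der a' k' b' c' d' f' g'" by (rule D_n4_derE)
  note comps = vec_eq_iff forall_4 vector_add_component vector_scaleR_component real_scaleR_def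
    zero_index n4_nth cf_def n4_der_nth
  note \<tau> = ker[folded \<tau>_def, unfolded E comps]
  have "D e W1 = l *\<^sub>R W1" "D e W2 = W1 + l *\<^sub>R W2"
    using DV[of \<tau>] DW[of \<tau>] ker by (simp_all add: W1_def W2_def \<tau>_def linear_0[OF linear_D_apply])
  note W = this[unfolded E comps]
  have "n4 \<tau> T1 + D e T1 = l *\<^sub>R T1 + W1" "n4 \<tau> T2 + D e T2 = T1 + l *\<^sub>R T2 + W2"
    using t'.t_br[of e v] t'.t_br[of e w]
    by (simp_all add: v w linear_cmul[OF t'.linear_t] linear_add[OF t'.linear_t]
        T1_def T2_def W1_def W2_def \<tau>_def algebra_simps)
  note T = this[unfolded E comps]
  have T0: "T1 \<noteq> 0" using t'(2) \<open>v \<noteq> 0\<close> by (simp add: T1_def)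
  have W2: "W2 = n4_der a' k' b' c' d' f' g' \<tau>" by (simp add: W2_def X)
  have lC: "l \<in> {a, k, a + k, 2 * a + k}" by (rule eigenvalue[OF E v \<open>v \<noteq> 0\<close>])
  consider "a = 0" "k \<noteq> 0" | "k = 0" "a \<noteq> 0" | "k = - a" "a \<noteq> 0" | "k = - 2 * a" "a \<noteq> 0"
    using zero_eigenvalue[OF E e] nz by fastforce
  \<comment> \<open>These are the cases in which \<open>l\<close> is a simple diagonal entry; the
    diagonals are \<open>(a, 0, a, 2 a)\<close>, \<open>(a, - a, 0, a)\<close> and
    \<open>(a, - 2 a, - a, 0)\<close>.\<close>
  then consider (1) "k = 0" "a \<noteq> 0" "l = 2 * a" | (2) "k = - a" "a \<noteq> 0" "l = - a"
    | (3) "k = - 2 * a" "a \<noteq> 0" "l = a \<or> l = - a \<or> l = - 2 * a"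
  proof cases
    case 1 then show ?thesis using lC l not by simp
  next
    case 2 then show ?thesis using lC l not that(1) by auto
  next
    case 3 then show ?thesis using lC l not that(2) by auto
  next
    case 4 then show ?thesis using lC l that(3) by auto
  qed
  then show False
  proof cases
    \<comment> \<open>Here \<open>W2$4\<close> may be nonzero and cancel \<open>T1$4\<close>, so the
      last row gives no contradiction. Instead \<open>T1\<close> and \<open>T2\<close> have only a
      fourth coordinate, against the independence of \<open>v\<close> and \<open>w\<close>.\<close>
    case 1
    have z1: "W1$1 = 0" "W2$1 = 0" using W 1 by auto
    then have z2: "W1$2 = 0" "W2$2 = 0" using W 1 by auto
    then have z3: "W1$3 = 0" "W2$3 = 0" using W z1 1 by auto
    have z4: "W1$4 = 0" using W z1 z2 z3 1 by auto
    have u1: "\<tau>$1 = 0" "T1$1 = 0" using \<tau> T z1 z4 1 by auto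
    have u1': "T2$1 = 0" using T z1 u1 1 by auto
    have u2: "T1$2 = 0" using T z2 u1 1 by auto
    then have u2': "T2$2 = 0" using T z1 z2 u1 u1' 1 by auto
    have u3: "T1$3 = 0" using T z3 u1 u2 1 by auto
    have u3': "T2$3 = 0" using T z3 u1 u1' u2 u2' u3 1 by auto
    have s: "T1$4 \<noteq> 0" using T0 u1 u2 u3 by (auto simp: vec_eq_iff forall_4)
    have "t' (w - (T2$4 / T1$4) *\<^sub>R v) = 0"
      using s u1 u2 u3 u1' u2' u3'
      by (simp add: linear_diff[OF t'.linear_t] linear_cmul[OF t'.linear_t] flip: T1_def T2_def)
        (simp add: vec_eq_iff forall_4)
    then show False using t'(2) indep by (metis eq_iff_diff_eq_0)
  next
    case 2
    have z: "\<tau>$1 = 0" using \<tau> 2 by auto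
    then have z': "\<tau>$2 = 0" using \<tau> 2 by auto
    \<comment> \<open>The first two coordinates of \<open>\<tau>\<close> vanish and
      \<open>D w\<close> is triangular, so \<open>W2\<close> cannot disturb the pivot row, which is
      the second.\<close>
    have y: "W2$1 = 0" "W2$2 = 0" using z z' by (simp_all add: W2)
    have x1: "W1$1 = 0" using W 2 by auto
    have x2: "W1$2 = 0" using W y 2 by auto
    then have x3: "W1$3 = 0" using W x1 2 by auto
    then have x4: "W1$4 = 0" using W x1 x2 2 by auto
    have u1: "T1$1 = 0" using T 2 x1 by auto
    then have u1': "T2$1 = 0" using T 2 y by auto
    then have u2: "T1$2 = 0" using T 2 y z by auto
    then have u3: "T1$3 = 0" using T 2 x3 u1 z by auto
    then have "T1$4 = 0" using T 2 x4 u1 u2 z by auto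
    then show False using T0 u1 u2 u3 by (simp add: vec_eq_iff forall_4)
  next
    case 3
    have z: "\<tau>$1 = 0" using \<tau> 3 by auto
    then have z': "\<tau>$2 = 0" using \<tau> 3 by auto
    then have z'': "\<tau>$3 = 0" using \<tau> z 3 by auto
    have y: "W2$1 = 0" "W2$2 = 0" "W2$3 = 0" using z z' z'' by (simp_all add: W2)
    have x: "W1$1 = 0" "W1$2 = 0" "W1$3 = 0" using W y by auto
    have "W1$4 = 0" using W x 3 by auto
    note x = x this
    have "T1$1 = 0 \<and> T1$2 = 0 \<and> T1$3 = 0 \<and> T1$4 = 0"
      using 3(3)
    proof (elim disjE)
      assume l: "l = a"
      have u1: "T1$1 = 0" using T y l by auto
      then have u2: "T1$2 = 0" using T 3 l x by auto
      then have u3: "T1$3 = 0" using T 3 l u1 x by auto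
      then show ?thesis using T 3 l u1 u2 x z by auto
    next
      assume l: "l = - a"
      have u1: "T1$1 = 0" "T2$1 = 0" using T 3 y l x by auto
      then have u2: "T1$2 = 0" "T2$2 = 0" using T 3 y l x by auto
      then have u3: "T1$3 = 0" using T 3 l u1 x y by auto
      then show ?thesis using T 3 l u1 u2 x z by auto
    next
      assume l: "l = - 2 * a"
      have u1: "T1$1 = 0" "T2$1 = 0" using T 3 y l x by auto
      then have u2: "T1$2 = 0" using T 3 y l x by auto
      then have u3: "T1$3 = 0" using T 3 l u1 x y by auto
      then show ?thesis using T 3 l u1 u2 x z by auto
    qed
    then show False using T0 by (simp add: vec_eq_iff forall_4)
  qed
qed

end

section \<open>The algebras that survive the constraints\<close>

lemma lie_isomorphic_basis:
  fixes br :: "'g::real_vector \<Rightarrow> 'g \<Rightarrow> 'g"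
  assumes "lie_isomorphic br br'"
  shows "\<exists>f. linear f \<and> inj f \<and> (\<forall>x y. br (f x) (f y) = f (br' x y))"
proof -
  obtain g where g: "linear g" "bij g" "\<And>x y. g (br x y) = br' (g x) (g y)"
    using assms by (auto simp: lie_isomorphic_def)
  define h where "h = inv_into UNIV g"
  have 1: "h (g x) = x" and 2: "g (h y) = y" for x y
    using g(2) by (simp_all add: h_def bij_is_inj bij_is_surj surj_f_inv_f)
  have "linear h"
  proof (intro linearI)
    show "h (x + y) = h x + h y" for x y
      using 1[of "h x + h y"] by (simp add: linear_add[OF g(1)] 2)
    show "h (r *\<^sub>R x) = r *\<^sub>R h x" for r x
      using 1[of "r *\<^sub>R h x"] by (simp add: linear_cmul[OF g(1)] 2)
  qed
  moreover have "inj h" using g(2) by (simp add: h_def bij_imp_bij_inv bij_is_inj)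
  moreover have "br (h x) (h y) = h (br' x y)" for x y
    using 1[of "br (h x) (h y)"] by (simp add: g(3) 2)
  ultimately show ?thesis by blast
qed

lemma (in n4_etale_rep)
  shows not_rr3: "\<not> lie_isomorphic br rr3"
    and not_d4: "\<not> lie_isomorphic br d4"
    and not_d4l': "\<not> lie_isomorphic br (d4l' \<mu>)"
    and r4_cases: "lie_isomorphic br (r4 \<mu>) \<Longrightarrow> \<mu> \<in> {-1, 1/2, 1}"
    and d4l_cases: "lie_isomorphic br (d4l \<mu>) \<Longrightarrow> \<mu> \<ge> 1/2 \<Longrightarrow> \<mu> \<in> {1/2, 2}"
proof -
  \<comment> \<open>A nonzero eigenvalue of \<open>ad e_1\<close> excludes a nilpotent
    \<open>D e_1\<close>, so a vector \<open>w\<close> outside the span of \<open>e_1\<close> that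
    commutes with it contradicts \<open>centralizer\<close>. This also removes
    \<open>\<mu> = 0\<close> for \<open>r4\<close> and \<open>\<mu> = 1\<close> for
    \<open>d4l\<close>.\<close>
  have no: False
    if f: "linear f" "inj f" "\<And>x y. br (f x) (f y) = f (br' x y)"
      and br': "br' (ee 1) (ee 1) = 0" "br' (ee 1) v = l *\<^sub>R v" "v \<noteq> 0" "l \<noteq> 0"
        "br' (ee 1) w = 0" "w \<notin> range (\<lambda>r. r *\<^sub>R ee 1)"
    for f :: "real^4 \<Rightarrow> 'a" and br' v w l
  proof -
    obtain a k b c d f' g where E: "D (f (ee 1)) = n4_der a k b c d f' g" by (rule D_n4_derE)
    have f0: "f x = 0 \<longleftrightarrow> x = 0" for x using f(1,2) by (metis linear_injective_0 linear_0)
    have e: "f (ee 1) \<noteq> 0" "br (f (ee 1)) (f (ee 1)) = 0"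
      by (simp_all add: f(3) br' f0 axis_eq_0_iff)
    have "l \<in> {a, k, a + k, 2 * a + k}"
      by (rule eigenvalue[OF E, of "f v"]) (simp_all add: f(3) br' f0 linear_cmul[OF f(1)])
    then have "a \<noteq> 0 \<or> k \<noteq> 0" using \<open>l \<noteq> 0\<close> by auto
    moreover have "br (f (ee 1)) (f w) = 0" by (simp add: f(3) br' f0)
    ultimately obtain r where "f w = r *\<^sub>R f (ee 1)" using centralizer[OF E] e by blast
    then have "f w = f (r *\<^sub>R ee 1)" by (simp add: linear_cmul[OF f(1)])
    then show False using f(2) br' by (auto dest: injD)
  qed
  note simps = vec_eq_iff forall_4 axis_def cf_def image_iff
  show "\<not> lie_isomorphic br rr3"
    by (auto dest!: lie_isomorphic_basis dest: no[of _ rr3 "ee 2" 1 "ee 4"] simp: rr3_def simps)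
  show "\<not> lie_isomorphic br d4"
    by (auto dest!: lie_isomorphic_basis dest: no[of _ d4 "ee 2" 1 "ee 4"] simp: d4_def simps)
  show "\<not> lie_isomorphic br (d4l' \<mu>)"
  proof
    assume "lie_isomorphic br (d4l' \<mu>)"
    then obtain f where f: "linear f" "inj f" "\<And>x y. br (f x) (f y) = f (d4l' \<mu> x y)"
      using lie_isomorphic_basis by blast
    have d: "d4l' \<mu> (ee 1) (ee 2) = \<mu> *\<^sub>R ee 2 - ee 3" "d4l' \<mu> (ee 1) (ee 3) = ee 2 + \<mu> *\<^sub>R ee 3"
      by (auto simp: d4l'_def simps)
    have "f (ee 2) \<noteq> 0" using f(1,2) by (metis linear_injective_0 axis_eq_0_iff zero_neq_one)
    then show False
      using no_complex_eigenvalue[of "f (ee 1)" "f (ee 2)" \<mu> "f (ee 3)"] f d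
      by (simp add: linear_add linear_diff linear_cmul)
  qed
  show "\<mu> \<in> {-1, 1/2, 1}" if "lie_isomorphic br (r4 \<mu>)"
  proof -
    obtain f where f: "linear f" "inj f" "\<And>x y. br (f x) (f y) = f (r4 \<mu> x y)"
      using lie_isomorphic_basis[OF \<open>lie_isomorphic br (r4 \<mu>)\<close>] by blast
    have f0: "f x = 0 \<longleftrightarrow> x = 0" for x using f(1,2) by (metis linear_injective_0 linear_0)
    have r: "r4 \<mu> (ee 1) (ee 1) = 0" "r4 \<mu> (ee 1) (ee 2) = ee 2" "r4 \<mu> (ee 1) (ee 3) = \<mu> *\<^sub>R ee 3"
      "r4 \<mu> (ee 1) (ee 4) = ee 3 + \<mu> *\<^sub>R ee 4"
      by (auto simp: r4_def simps)
    obtain a k b c d f' g where E: "D (f (ee 1)) = n4_der a k b c d f' g" by (rule D_n4_derE)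
    have e: "f (ee 1) \<noteq> 0" "br (f (ee 1)) (f (ee 1)) = 0" by (simp_all add: f(3) r f0 axis_eq_0_iff)
    have 1: "1 \<in> {a, k, a + k, 2 * a + k}"
      by (rule eigenvalue[OF E, of "f (ee 2)"]) (simp_all add: f(3) r f0 axis_eq_0_iff)
    then have nz: "a \<noteq> 0 \<or> k \<noteq> 0" by auto
    have "\<mu> \<noteq> 0"
      using no[OF f, of "ee 2" 1 "ee 3"] r by (auto simp: axis_eq_0_iff) (auto simp: simps)
    moreover have "f (ee 4) \<noteq> s *\<^sub>R f (ee 3)" for s
    proof
      assume "f (ee 4) = s *\<^sub>R f (ee 3)"
      then have "ee 4 = s *\<^sub>R ee 3" using f(1,2) by (metis linear_cmul injD)
      then show False by (simp add: simps)
    qed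
    ultimately have "a = 0 \<and> \<mu> = k \<or> k = 0 \<and> \<mu> = a \<or> k = - a \<and> \<mu> = a"
      by (intro jordan_block[OF E nz e(2,1), of "f (ee 3)" \<mu> "f (ee 4)"])
        (simp_all add: f(3) r f0 axis_eq_0_iff linear_add[OF f(1)] linear_cmul[OF f(1)])
    \<comment> \<open>The diagonals \<open>(0, \<mu>, \<mu>, \<mu>)\<close>,
      \<open>(\<mu>, 0, \<mu>, 2 \<mu>)\<close> and \<open>(\<mu>, - \<mu>, 0, \<mu>)\<close> must
      contain 1.\<close>
    then show ?thesis using 1 by auto
  qed
  show "\<mu> \<in> {1/2, 2}" if "lie_isomorphic br (d4l \<mu>)" "\<mu> \<ge> 1/2"
  proof -
    obtain f where f: "linear f" "inj f" "\<And>x y. br (f x) (f y) = f (d4l \<mu> x y)"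
      using lie_isomorphic_basis[OF \<open>lie_isomorphic br (d4l \<mu>)\<close>] by blast
    have f0: "f x = 0 \<longleftrightarrow> x = 0" for x using f(1,2) by (metis linear_injective_0 linear_0)
    have r: "d4l \<mu> (ee 1) (ee 1) = 0" "d4l \<mu> (ee 1) (ee 2) = \<mu> *\<^sub>R ee 2"
      "d4l \<mu> (ee 1) (ee 3) = (1 - \<mu>) *\<^sub>R ee 3" "d4l \<mu> (ee 1) (ee 4) = ee 4"
      by (auto simp: d4l_def simps)
    obtain a k b c d f' g where E: "D (f (ee 1)) = n4_der a k b c d f' g" by (rule D_n4_derE)
    have e: "f (ee 1) \<noteq> 0" "br (f (ee 1)) (f (ee 1)) = 0" by (simp_all add: f(3) r f0 axis_eq_0_iff)
    have 1: "1 \<in> {a, k, a + k, 2 * a + k}"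
      by (rule eigenvalue[OF E, of "f (ee 4)"]) (simp_all add: f(3) r f0 axis_eq_0_iff)
    have 2: "\<mu> \<in> {a, k, a + k, 2 * a + k}"
      by (rule eigenvalue[OF E, of "f (ee 2)"]) (simp_all add: f(3) r f0 axis_eq_0_iff linear_cmul[OF f(1)])
    have 3: "1 - \<mu> \<in> {a, k, a + k, 2 * a + k}"
      by (rule eigenvalue[OF E, of "f (ee 3)"]) (simp_all add: f(3) r f0 axis_eq_0_iff linear_cmul[OF f(1)])
    have "\<mu> \<noteq> 1"
      using no[OF f, of "ee 4" 1 "ee 3"] r by (auto simp: axis_eq_0_iff) (auto simp: simps)
    \<comment> \<open>All of \<open>1\<close>, \<open>\<mu>\<close>, \<open>1 - \<mu>\<close> must
      occur on the diagonal: \<open>(1/2, 0, 1/2, 1)\<close> and \<open>(-1/2, 1, 1/2, 0)\<close>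
      give \<open>1/2\<close>, and \<open>(-1, 2, 1, 0)\<close> gives \<open>2\<close>.\<close>
    then show ?thesis
      using zero_eigenvalue[OF E e(2,1)] 1 2 3 \<open>\<mu> \<ge> 1/2\<close> by (elim disjE insertE emptyE) auto
  qed
qed

section \<open>Affine transformations of \<open>N4\<close> and their orbit maps\<close>

lemma smooth_on_imp_differentiable: "smooth_on S f \<Longrightarrow> x \<in> S \<Longrightarrow> f differentiable (at x)"
  by (metis smooth_on_def differentiable_times_on.simps(2))

lemma N4_sel [simp]: "carrier N4 = UNIV" "x \<otimes>\<^bsub>N4\<^esub> y = N4_mult x y" "\<one>\<^bsub>N4\<^esub> = 0"
  by (simp_all add: N4_def)

lemma N4_mult_scaleR: "N4_mult (r *\<^sub>R x) (s *\<^sub>R x) = (r + s) *\<^sub>R x"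
  by (simp add: N4_mult_def vec4_simps algebra_simps)

lemma N4_mult_assoc: "N4_mult (N4_mult x y) z = N4_mult x (N4_mult y z)"
  using monoid.m_assoc[OF group.is_monoid[OF group_N4], of x y z] by simp

lemma hom_N4_natural_multiple:
  assumes "\<And>x y. \<alpha> (N4_mult x y) = N4_mult (\<alpha> x) (\<alpha> y)"
  shows "\<alpha> (real n *\<^sub>R x) = real n *\<^sub>R \<alpha> x"
proof (induction n)
  case 0
  have "\<alpha> 0 = 2 *\<^sub>R \<alpha> 0"
    using assms[of 0 0] N4_mult_scaleR[of 0 0 0] N4_mult_scaleR[of 1 "\<alpha> 0" 1] by simp
  then show ?case by (simp add: scaleR_2)
next
  case (Suc n)
  have "\<alpha> (real (Suc n) *\<^sub>R x) = \<alpha> (N4_mult (real n *\<^sub>R x) (1 *\<^sub>R x))"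
    unfolding N4_mult_scaleR by (simp add: add.commute)
  also have "\<dots> = N4_mult (real n *\<^sub>R \<alpha> x) (1 *\<^sub>R \<alpha> x)" using assms Suc by simp
  also have "\<dots> = real (Suc n) *\<^sub>R \<alpha> x" unfolding N4_mult_scaleR by (simp add: add.commute)
  finally show ?case .
qed

text \<open>A homomorphism is homogeneous along the one-parameter groups \<open>s \<mapsto> s x\<close>, so it agrees with
  its differential.\<close>

lemma lie_automorphism_N4_eq_derivative:
  assumes "\<alpha> \<in> lie_automorphisms N4"
  shows "frechet_derivative \<alpha> (at 0) = \<alpha>" and "linear \<alpha>"
proof -
  have hom: "\<alpha> (N4_mult x y) = N4_mult (\<alpha> x) (\<alpha> y)" for x y
    using assms by (simp add: lie_automorphisms_def iso_def hom_def)
  have "\<alpha> differentiable (at 0)"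
    using assms smooth_on_imp_differentiable by (auto simp: lie_automorphisms_def)
  then have d: "(\<alpha> has_derivative frechet_derivative \<alpha> (at 0)) (at 0)"
    by (simp add: frechet_derivative_works)
  have a0: "\<alpha> 0 = 0" using hom_N4_natural_multiple[OF hom, of 0 0] by simp
  have "frechet_derivative \<alpha> (at 0) x = \<alpha> x" for x
  proof -
    define L where "L = frechet_derivative \<alpha> (at 0)"
    define h where "h n = (1 / real (Suc n)) *\<^sub>R x" for n
    have lin: "linear L" using d unfolding L_def by (rule has_derivative_linear)
    show ?thesis
    proof (cases "x = 0")
      case True then show ?thesis using lin linear_0 a0 by (auto simp: L_def)
    next
      case False
      have "(\<lambda>y. norm (\<alpha> (0 + y) - \<alpha> 0 - L y) / norm y) \<midarrow>0\<rightarrow> 0"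
        using d by (simp only: has_derivative_at L_def)
      moreover have "h \<longlonglongrightarrow> 0"
        unfolding h_def using tendsto_scaleR[OF LIMSEQ_inverse_real_of_nat tendsto_const, of x]
        by (simp add: inverse_eq_divide)
      ultimately have "(\<lambda>n. norm (\<alpha> (0 + h n) - \<alpha> 0 - L (h n)) / norm (h n)) \<longlonglongrightarrow> 0"
        by (rule tendsto_compose_eventually) (use False in \<open>simp add: h_def\<close>)
      moreover have "\<alpha> (h n) = (1 / real (Suc n)) *\<^sub>R \<alpha> x" for n
        using hom_N4_natural_multiple[OF hom, of "Suc n" "h n"] by (simp add: h_def)
      \<comment> \<open>Homogeneity makes the remainder quotient constant along \<open>h\<close>,
        while differentiability sends it to 0.\<close>
      then have "norm (\<alpha> (0 + h n) - \<alpha> 0 - L (h n)) / norm (h n) = norm (\<alpha> x - L x) / norm x" for n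
        by (simp add: a0 h_def linear_cmul[OF lin] flip: scaleR_diff_right)
      ultimately have "norm (\<alpha> x - L x) / norm x = 0" by (simp add: LIMSEQ_const_iff)
      then show ?thesis using False by (simp add: L_def)
    qed
  qed
  then show "frechet_derivative \<alpha> (at 0) = \<alpha>" by blast
  then show "linear \<alpha>" using has_derivative_linear[OF d] by simp
qed

lemma aff_act_aff_coord:
  assumes "\<gamma> \<in> carrier (aff_group N4)"
  shows "aff_act N4 \<gamma> p = N4_mult (fst (aff_coord \<gamma>)) (snd (aff_coord \<gamma>) p)"
proof -
  obtain h \<alpha> where g: "\<gamma> = (h, \<alpha>)" "\<alpha> \<in> lie_automorphisms N4"
    using assms by (auto simp: aff_group_def)
  show ?thesis
    using lie_automorphism_N4_eq_derivative[OF g(2)]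
    by (simp add: g(1) aff_act_def aff_coord_def bounded_linear_Blinfun_apply linear_conv_bounded_linear)
qed

lemma aff_act_mult:
  assumes "\<gamma> \<in> carrier (aff_group N4)"
  shows "aff_act N4 (\<gamma> \<otimes>\<^bsub>aff_group N4\<^esub> \<delta>) p = aff_act N4 \<gamma> (aff_act N4 \<delta> p)"
  using assms
  by (auto simp: aff_group_def aff_act_def lie_automorphisms_def iso_def hom_def N4_mult_assoc split: prod.splits)

text \<open>Identifies \<open>\<rho> \<one>\<close>, which is idempotent, without establishing the
  group laws of \<open>aff_group N4\<close>.\<close>

lemma aff_group_N4_idempotent:
  assumes "\<gamma> \<in> carrier (aff_group N4)" "\<gamma> \<otimes>\<^bsub>aff_group N4\<^esub> \<gamma> = \<gamma>"
  shows "\<gamma> = (0, id)"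
proof -
  obtain h \<alpha> where g: "\<gamma> = (h, \<alpha>)" "\<alpha> \<in> lie_automorphisms N4"
    using assms by (auto simp: aff_group_def)
  have *: "\<alpha> \<circ> \<alpha> = \<alpha>" "N4_mult h (\<alpha> h) = h" using assms(2) by (auto simp: aff_group_def g)
  have "inj \<alpha>" using g(2) by (auto simp: lie_automorphisms_def iso_def bij_betw_def)
  then have "\<alpha> = id" using *(1) by (metis comp_apply eq_id_iff injD)
  with *(2) have "2 *\<^sub>R h = h" using N4_mult_scaleR[of 1 h 1] by simp
  with \<open>\<alpha> = id\<close> show ?thesis by (simp add: g(1) scaleR_2)
qed

text \<open>This justifies the formula \<open>aff_field\<close>: it is the velocity of the orbit map
  through \<open>p\<close> at the identity.\<close>

lemma has_derivative_N4_mult_blinfun: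
  fixes F :: "'a::real_normed_vector \<Rightarrow> (real^4) \<times> ((real^4) \<Rightarrow>\<^sub>L (real^4))"
  assumes F: "(F has_derivative F') (at z)" and z: "F z = (0, id_blinfun)"
  shows "((\<lambda>y. N4_mult (fst (F y)) (snd (F y) p)) has_derivative (\<lambda>v. aff_field (fst (F' v)) (snd (F' v)) p)) (at z)"
proof -
  interpret n4: bounded_bilinear n4 by (rule bounded_bilinear_n4)
  have f: "((\<lambda>y. fst (F y)) has_derivative (\<lambda>v. fst (F' v))) (at z)"
    and s: "((\<lambda>y. snd (F y) p) has_derivative (\<lambda>v. snd (F' v) p)) (at z)"
    by (auto intro!: derivative_eq_intros F)
  show ?thesis
    unfolding N4_mult_def aff_field_def
    by (rule derivative_eq_intros n4.FDERIV f s refl)+ (simp add: z n4_zero fun_eq_iff)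
qed

lemma has_derivative_N4_translation:
  fixes A :: "real^4 \<Rightarrow> real^4"
  assumes "linear A"
  shows "\<exists>L. ((\<lambda>q. N4_mult h (A q)) has_derivative L) (at q)"
proof -
  interpret n4: bounded_bilinear n4 by (rule bounded_bilinear_n4)
  have A: "(A has_derivative A) (at q)"
    by (rule bounded_linear_imp_has_derivative[OF linear_conv_bounded_linear[THEN iffD1, OF assms]])
  show ?thesis
    unfolding N4_mult_def
    by (intro exI) (rule derivative_intros n4.FDERIV A)+
qed

text \<open>Otherwise some orbit map \<open>\<Theta>\<close> would be singular at the identity, hence everywhere since \<open>\<rho> g\<close>
  intertwines it with left translations; by Sard's theorem and second countability its image, which
  is the whole space, would be negligible.\<close>

lemma orbit_map_immersive:
  fixes G :: "(real^4, real^4) lie_grp"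
  assumes G: "lie_group G" and \<kappa>: "(U, c) \<in> charts G" "\<one>\<^bsub>G\<^esub> \<in> U"
    and hom: "smooth_hom_to_aff G N4 \<rho>" and trans: "simply_transitive_on G N4 \<rho>"
    and x: "x \<noteq> 0"
  shows "aff_field (fst (differential_at_one G (U, c) \<rho> x)) (snd (differential_at_one G (U, c) \<rho> x)) p \<noteq> 0"
proof
  assume zero: "aff_field (fst (differential_at_one G (U, c) \<rho> x)) (snd (differential_at_one G (U, c) \<rho> x)) p = 0"
  interpret G: group G using G by (simp add: lie_group_def)
  have top: "topspace (gtop G) = carrier G" and man: "smooth_manifold (gtop G) (charts G)"
    and mult: "smooth_map (prod_topology (gtop G) (gtop G)) (prod_charts (charts G) (charts G))
       (gtop G) (charts G) (\<lambda>(x, y). x \<otimes>\<^bsub>G\<^esub> y)"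
    using G by (simp_all add: lie_group_def)
  have chart: "openin (gtop G) V" "open (d ` V)" "inj_on d V" "V \<subseteq> carrier G"
    "continuous_map (top_of_set (d ` V)) (gtop G) (inv_into V d)"
    if "(V, d) \<in> charts G" for V d
  proof -
    have *: "openin (gtop G) V" "open (d ` V)"
      "homeomorphic_map (subtopology (gtop G) V) (top_of_set (d ` V)) d"
      using man that by (auto simp: smooth_manifold_def)
    then show "openin (gtop G) V" "open (d ` V)" by simp_all
    show "V \<subseteq> carrier G" using *(1) openin_subset top by blast
    then have V: "topspace (subtopology (gtop G) V) = V" by (simp add: top Int_absorb1)
    show inj: "inj_on d V"
      using *(3) V by (metis homeomorphic_imp_injective_map)
    have "homeomorphic_map (top_of_set (d ` V)) (subtopology (gtop G) V) (inv_into V d)"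
    proof -
      obtain g where g: "homeomorphic_maps (subtopology (gtop G) V) (top_of_set (d ` V)) d g"
        using *(3) homeomorphic_map_maps by blast
      then have "g y = inv_into V d y" if "y \<in> d ` V" for y
        using that V inj by (auto simp: homeomorphic_maps_def)
      moreover have "homeomorphic_map (top_of_set (d ` V)) (subtopology (gtop G) V) g"
        using g homeomorphic_maps_sym homeomorphic_maps_map by blast
      ultimately show ?thesis by (auto intro: homeomorphic_map_eq)
    qed
    then show "continuous_map (top_of_set (d ` V)) (gtop G) (inv_into V d)"
      using homeomorphic_imp_continuous_map continuous_map_in_subtopology by blast
  qed
  define A where "A = aff_coord \<circ> \<rho> \<circ> inv_into U c"
  define \<Theta> where "\<Theta> g = aff_act N4 (\<rho> g) p" for g
  have \<rho>: "\<rho> g \<in> carrier (aff_group N4)" "\<rho> (g \<otimes>\<^bsub>G\<^esub> k) = \<rho> g \<otimes>\<^bsub>aff_group N4\<^esub> \<rho> k"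
    if "g \<in> carrier G" "k \<in> carrier G" for g k
    using hom that by (auto simp: smooth_hom_to_aff_def hom_def)
  have \<rho>1: "\<rho> \<one>\<^bsub>G\<^esub> = (0, id)"
    using \<rho>[of "\<one>\<^bsub>G\<^esub>" "\<one>\<^bsub>G\<^esub>"] by (intro aff_group_N4_idempotent) simp_all
  have "A differentiable (at (c \<one>\<^bsub>G\<^esub>))"
    using hom \<kappa> unfolding A_def smooth_hom_to_aff_def
    by (intro smooth_on_imp_differentiable[of "c ` U"]) auto
  then have dA: "(A has_derivative differential_at_one G (U, c) \<rho>) (at (c \<one>\<^bsub>G\<^esub>))"
    by (simp add: frechet_derivative_works differential_at_one_def A_def)
  have "A (c \<one>\<^bsub>G\<^esub>) = (0, id_blinfun)"
    using \<kappa> chart(3)[OF \<kappa>(1)]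
    by (simp add: A_def \<rho>1 aff_coord_def frechet_derivative_id flip: id_def)
      (simp add: id_def id_blinfun.abs_eq)
  note dN = has_derivative_N4_mult_blinfun[OF dA this, of p]
  define \<Theta>c where "\<Theta>c y = N4_mult (fst (A y)) (snd (A y) p)" for y
  define \<Theta>' where "\<Theta>' v = aff_field (fst (differential_at_one G (U, c) \<rho> v)) (snd (differential_at_one G (U, c) \<rho> v)) p" for v
  have d\<Theta>: "(\<Theta>c has_derivative \<Theta>') (at (c \<one>\<^bsub>G\<^esub>))"
    using dN unfolding \<Theta>c_def \<Theta>'_def .
  have lin\<Theta>: "linear \<Theta>'" using d\<Theta> by (rule has_derivative_linear)
  have "\<not> inj \<Theta>'" using zero x linear_0[OF lin\<Theta>] by (metis \<Theta>'_def injD)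
  then have nosurj: "\<not> surj \<Theta>'" using lin\<Theta> linear_surj_imp_inj by blast
  have \<Theta>c: "\<Theta>c (c g) = \<Theta> g" if "g \<in> U" for g
  proof -
    have "g \<in> carrier G" using that chart(4)[OF \<kappa>(1)] by blast
    then show ?thesis
      using that chart(3)[OF \<kappa>(1)] by (simp add: \<Theta>c_def \<Theta>_def A_def aff_act_aff_coord \<rho>)
  qed
  have singular: "\<exists>L. ((\<Theta> \<circ> inv_into V d) has_derivative L) (at y) \<and> \<not> surj L"
    if V: "(V, d) \<in> charts G" and y: "y \<in> d ` V" for V d y
  proof -
    define g where "g = inv_into V d y"
    define h where "h = inv\<^bsub>G\<^esub> g"
    have g: "g \<in> carrier G" "h \<in> carrier G" "h \<otimes>\<^bsub>G\<^esub> g = \<one>\<^bsub>G\<^esub>" "d g = y" "g \<in> V"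
    proof -
      show "g \<in> V" "d g = y" using y by (simp_all add: g_def inv_into_into f_inv_into_f)
      then show "g \<in> carrier G" using chart(4)[OF V] by blast
      then show "h \<in> carrier G" "h \<otimes>\<^bsub>G\<^esub> g = \<one>\<^bsub>G\<^esub>" by (simp_all add: h_def)
    qed
    obtain U0 c0 where U0: "(U0, c0) \<in> charts G" "h \<in> U0"
    proof -
      have "h \<in> (\<Union>(U, c)\<in>charts G. U)" using man g(2) top by (simp add: smooth_manifold_def)
      then show ?thesis using that by auto
    qed
    \<comment> \<open>Multiplication in charts. Freezing the first argument at \<open>c0 h\<close>
      gives left translation by the inverse of \<open>g\<close>, which brings a neighbourhood of
      \<open>g\<close> into the chart at the identity.\<close>
    define f where "f = c \<circ> (\<lambda>(x, y). x \<otimes>\<^bsub>G\<^esub> y) \<circ> inv_into (U0 \<times> V) (map_prod c0 d)"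
    have "(U0 \<times> V, map_prod c0 d) \<in> prod_charts (charts G) (charts G)"
      unfolding prod_charts_def using U0 V by (intro image_eqI[of _ _ "((U0, c0), (V, d))"]) simp_all
    then have "smooth_on (map_prod c0 d ` (U0 \<times> V \<inter> (\<lambda>(x, y). x \<otimes>\<^bsub>G\<^esub> y) -` U)) f"
      using mult \<kappa>(1) unfolding smooth_map_def f_def by (metis (no_types, lifting) case_prodD)
    moreover have "(c0 h, y) \<in> map_prod c0 d ` (U0 \<times> V \<inter> (\<lambda>(x, y). x \<otimes>\<^bsub>G\<^esub> y) -` U)"
      using U0 g \<kappa> by (intro image_eqI[of _ _ "(h, g)"]) auto
    ultimately have df: "f differentiable (at (c0 h, y))"
      by (rule smooth_on_imp_differentiable)
    have inj: "inj_on (map_prod c0 d) (U0 \<times> V)"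
      using chart(3)[OF U0(1)] chart(3)[OF V] by (simp add: map_prod_inj_on)
    have f: "f (c0 h, z) = c (h \<otimes>\<^bsub>G\<^esub> inv_into V d z)" if "z \<in> d ` V" for z
    proof -
      have "inv_into (U0 \<times> V) (map_prod c0 d) (c0 h, z) = (h, inv_into V d z)"
        using inv_into_f_f[OF inj, of "(h, inv_into V d z)"] that U0 by (simp add: inv_into_into f_inv_into_f)
      then show ?thesis by (simp add: f_def)
    qed
    obtain f' where f': "(f has_derivative f') (at (c0 h, y))"
      using df differentiable_def by blast
    have "((\<lambda>z. f (c0 h, z)) has_derivative (\<lambda>v. f' (0, v))) (at y)"
      by (rule has_derivative_compose[where f="\<lambda>z. (c0 h, z)" and g=f, simplified])
        (auto intro!: derivative_eq_intros f')
    moreover have fy: "f (c0 h, y) = c \<one>\<^bsub>G\<^esub>" using f[OF y] g by (simp flip: g_def)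
    ultimately have d1: "((\<lambda>z. \<Theta>c (f (c0 h, z))) has_derivative (\<lambda>v. \<Theta>' (f' (0, v)))) (at y)"
      using has_derivative_compose[of "\<lambda>z. f (c0 h, z)" _ y UNIV \<Theta>c \<Theta>'] d\<Theta> by simp
    have \<rho>g: "\<rho> g \<in> carrier (aff_group N4)" using \<rho>(1)[OF g(1) g(1)] .
    have "linear (snd (\<rho> g))"
      using \<rho>g lie_automorphism_N4_eq_derivative(2) by (auto simp: aff_group_def)
    then obtain L where L: "(aff_act N4 (\<rho> g) has_derivative L) (at (\<Theta>c (f (c0 h, y))))"
      using has_derivative_N4_translation[of "snd (\<rho> g)" "fst (\<rho> g)"]
      by (force simp: aff_act_def case_prod_unfold)
    have d2: "((\<lambda>z. aff_act N4 (\<rho> g) (\<Theta>c (f (c0 h, z)))) has_derivative (\<lambda>v. L (\<Theta>' (f' (0, v))))) (at y)"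
      using has_derivative_compose[OF d1 L] .
    \<comment> \<open>The factorization of the orbit map through this translation holds only where
      the translate stays in \<open>U\<close>; a derivative transfers because this set is
      open.\<close>
    have "openin (top_of_set (d ` V)) {z \<in> topspace (top_of_set (d ` V)). h \<otimes>\<^bsub>G\<^esub> inv_into V d z \<in> U}"
    proof (rule openin_continuous_map_preimage)
      have "continuous_map (prod_topology (gtop G) (gtop G)) (gtop G) (\<lambda>(x, y). x \<otimes>\<^bsub>G\<^esub> y)"
        using mult by (simp add: smooth_map_def)
      moreover have "continuous_map (top_of_set (d ` V)) (prod_topology (gtop G) (gtop G)) (\<lambda>z. (h, inv_into V d z))"
        by (intro continuous_map_pairedI chart(5)[OF V]) (simp add: g(2) top)
      ultimately have "continuous_map (top_of_set (d ` V)) (gtop G)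
          ((\<lambda>(x, y). x \<otimes>\<^bsub>G\<^esub> y) \<circ> (\<lambda>z. (h, inv_into V d z)))"
        by (rule continuous_map_compose[rotated])
      then show "continuous_map (top_of_set (d ` V)) (gtop G) (\<lambda>z. h \<otimes>\<^bsub>G\<^esub> inv_into V d z)"
        by (simp add: o_def)
      show "openin (gtop G) U" using chart(1)[OF \<kappa>(1)] .
    qed
    then have "open {z \<in> d ` V. h \<otimes>\<^bsub>G\<^esub> inv_into V d z \<in> U}"
      using chart(2)[OF V] openin_open_eq by (auto simp: Collect_conj_eq)
    moreover have "y \<in> {z \<in> d ` V. h \<otimes>\<^bsub>G\<^esub> inv_into V d z \<in> U}"
      using y g \<kappa> by (simp flip: g_def)
    moreover have "aff_act N4 (\<rho> g) (\<Theta>c (f (c0 h, z))) = (\<Theta> \<circ> inv_into V d) z"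
      if "z \<in> {z \<in> d ` V. h \<otimes>\<^bsub>G\<^esub> inv_into V d z \<in> U}" for z
    proof -
      have z: "z \<in> d ` V" "h \<otimes>\<^bsub>G\<^esub> inv_into V d z \<in> U" using that by auto
      then have k: "inv_into V d z \<in> carrier G" using chart(4)[OF V] inv_into_into[of z d V] by blast
      have "aff_act N4 (\<rho> g) (\<Theta>c (f (c0 h, z))) = aff_act N4 (\<rho> (g \<otimes>\<^bsub>G\<^esub> (h \<otimes>\<^bsub>G\<^esub> inv_into V d z))) p"
        using z k g by (simp add: f \<Theta>c \<Theta>_def \<rho> aff_act_mult)
      also have "g \<otimes>\<^bsub>G\<^esub> (h \<otimes>\<^bsub>G\<^esub> inv_into V d z) = inv_into V d z"
        using g(1) k by (simp add: h_def flip: G.m_assoc)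
      finally show ?thesis by (simp add: \<Theta>_def)
    qed
    ultimately have "((\<Theta> \<circ> inv_into V d) has_derivative (\<lambda>v. L (\<Theta>' (f' (0, v))))) (at y)"
      using has_derivative_transform_within_open[OF d2] by blast
    \<comment> \<open>A surjective composite makes \<open>L\<close> surjective, hence injective by
      equality of dimensions, so \<open>L\<close> cancels and \<open>\<Theta>'\<close> would be
      surjective.\<close>
    moreover have "\<not> surj (\<lambda>v. L (\<Theta>' (f' (0, v))))"
    proof
      assume s: "surj (\<lambda>v. L (\<Theta>' (f' (0, v))))"
      then have "surj L" unfolding surj_def by blast
      then have "inj L" by (rule linear_surj_imp_inj[OF has_derivative_linear[OF L]])
      have "\<exists>u. w = \<Theta>' u" for w
      proof -
        obtain v where "L w = L (\<Theta>' (f' (0, v)))" using s unfolding surj_def by blast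
        then show ?thesis using injD[OF \<open>inj L\<close>] by blast
      qed
      then have "surj \<Theta>'" unfolding surj_def by blast
      then show False using nosurj by blast
    qed
    ultimately show ?thesis by blast
  qed
  have negl: "negligible (\<Theta> ` V)" if V: "(V, d) \<in> charts G" for V d
  proof -
    obtain L where L: "\<And>y. y \<in> d ` V \<Longrightarrow> ((\<Theta> \<circ> inv_into V d) has_derivative L y) (at y) \<and> \<not> surj (L y)"
      using singular[OF V] by metis
    have "negligible ((\<Theta> \<circ> inv_into V d) ` (d ` V))"
    proof (rule baby_Sard)
      fix y assume y: "y \<in> d ` V"
      show "((\<Theta> \<circ> inv_into V d) has_derivative L y) (at y within d ` V)"
        using L[OF y] has_derivative_at_withinI by blast
      have "linear (L y)" using L[OF y] has_derivative_linear by blast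
      then have "\<not> surj ((*v) (matrix (L y)))" using L[OF y] by (simp add: matrix_works)
      then have "rank (matrix (L y)) \<noteq> CARD(4)" using full_rank_surjective by blast
      then show "rank (matrix (L y)) < CARD(4)" using rank_bound[of "matrix (L y)"] by simp
    qed simp
    also have "(\<Theta> \<circ> inv_into V d) ` (d ` V) = \<Theta> ` V"
      unfolding image_comp[symmetric] using chart(3)[OF V] by (simp only: inv_into_image_cancel subset_refl)
    finally show ?thesis .
  qed
  \<comment> \<open>The atlas may be uncountable; a countable subcover is what lets the negligible
    images add up to a negligible set.\<close>
  have "Lindelof_space (gtop G)"
    using man second_countable_imp_Lindelof_space by (auto simp: smooth_manifold_def)
  moreover have "\<forall>V \<in> fst ` charts G. openin (gtop G) V" using chart(1) by auto
  moreover have "\<Union> (fst ` charts G) = topspace (gtop G)"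
    using man by (auto simp: smooth_manifold_def case_prod_unfold)
  ultimately obtain \<V> where \<V>: "countable \<V>" "\<V> \<subseteq> fst ` charts G" "\<Union>\<V> = topspace (gtop G)"
    unfolding Lindelof_space_def by meson
  have "negligible (\<Union> ((`) \<Theta> ` \<V>))"
    using \<V> negl by (intro negligible_countable_Union) auto
  moreover have "\<Union> ((`) \<Theta> ` \<V>) = UNIV"
  proof -
    have "q \<in> \<Union> ((`) \<Theta> ` \<V>)" for q
    proof -
      obtain g where g: "g \<in> carrier G" "\<Theta> g = q"
        using trans unfolding simply_transitive_on_def \<Theta>_def by blast
      then obtain V where "V \<in> \<V>" "g \<in> V" using \<V>(3) top by blast
      then show ?thesis using g(2) by blast
    qed
    then show ?thesis by blast
  qed
  ultimately show False by simp
qed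

theorem simply_transitive_action_imp_n4_etale_rep:
  assumes "simply_transitive_action br N4 n4 \<phi>"
  shows "n4_etale_rep br (\<lambda>x. fst (\<phi> x)) (\<lambda>x. blinfun_apply (snd (\<phi> x)))"
proof -
  obtain G :: "(real^4, real^4) lie_grp" and U c \<iota> \<rho> where
    mor: "aff_morphism br n4 \<phi>" and G: "lie_group G" and \<iota>: "is_lie_algebra_of G (U, c) \<iota> br"
    and \<rho>: "smooth_hom_to_aff G N4 \<rho>" "simply_transitive_on G N4 \<rho>"
    and \<phi>: "\<And>x. differential_at_one G (U, c) \<rho> (\<iota> x) = \<phi> x"
    using assms unfolding simply_transitive_action_def split_paired_Ex by blast
  have "\<phi> x \<in> UNIV \<times> derivations n4" for x
    using mor unfolding aff_morphism_def aff_carrier_def by blast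
  then have der: "snd (\<phi> x) \<in> derivations n4" for x by (simp add: mem_Times_iff)
  have lin: "linear \<phi>"
    and br: "\<phi> (br x y) = aff_bracket n4 (\<phi> x) (\<phi> y)" for x y
    using mor by (auto simp: aff_morphism_def aff_carrier_def)
  show ?thesis
  proof (intro n4_etale_rep.intro n4_rep.intro n4_etale_rep_axioms.intro)
    show "linear (\<lambda>x. fst (\<phi> x))"
      using lin by (auto intro!: linearI simp: linear_add linear_cmul)
    show "linear (\<lambda>x. snd (\<phi> x) p)" for p
      using lin by (auto intro!: linearI simp: linear_add linear_cmul blinfun.add_left blinfun.scaleR_left)
    show "linear (blinfun_apply (snd (\<phi> x)))" for x
      by (simp add: blinfun.bounded_linear_right bounded_linear.linear)
    show "snd (\<phi> x) (n4 p q) = n4 (snd (\<phi> x) p) q + n4 p (snd (\<phi> x) q)" for x p q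
      using der[of x] by (simp add: derivations_def)
    show "fst (\<phi> (br x y)) = n4 (fst (\<phi> x)) (fst (\<phi> y)) + snd (\<phi> x) (fst (\<phi> y)) - snd (\<phi> y) (fst (\<phi> x))" for x y
      by (simp add: br aff_bracket_def case_prod_unfold)
    show "snd (\<phi> (br x y)) p = snd (\<phi> x) (snd (\<phi> y) p) - snd (\<phi> y) (snd (\<phi> x) p)" for x y p
      by (simp add: br aff_bracket_def case_prod_unfold blinfun.diff_left)
    show "aff_field (fst (\<phi> x)) (snd (\<phi> x)) p \<noteq> 0" if "x \<noteq> 0" for x p
    proof -
      have "\<iota> x \<noteq> 0"
        using \<iota> that unfolding is_lie_algebra_of_def by (metis bij_is_inj linear_injective_0)
      then show ?thesis
        using orbit_map_immersive[OF G _ _ \<rho>, of U c "\<iota> x" p] \<iota> by (simp add: \<phi> is_lie_algebra_of_def)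
    qed
  qed
qed

section \<open>Smoothness calculus on Euclidean space\<close>

lemma smooth_on_frechet_derivative:
  "smooth_on S f \<Longrightarrow> smooth_on S (\<lambda>x. frechet_derivative f (at x) v)"
  by (metis smooth_on_def differentiable_times_on.simps(2))

lemma smooth_on_const: "smooth_on UNIV (\<lambda>x. c)"
  by (simp add: smooth_on_def differentiable_times_on_const)

lemma smooth_on_mult:
  fixes f g :: "'a::euclidean_space \<Rightarrow> real"
  shows "smooth_on UNIV f \<Longrightarrow> smooth_on UNIV g \<Longrightarrow> smooth_on UNIV (\<lambda>x. f x * g x)"
  by (rule smooth_on_bilinear[OF bounded_bilinear_mult])

lemma smooth_on_scaleR_const:
  fixes f :: "'a::euclidean_space \<Rightarrow> real"
  shows "smooth_on UNIV f \<Longrightarrow> smooth_on UNIV (\<lambda>x. f x *\<^sub>R c)"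
  by (rule smooth_on_bilinear[OF bounded_bilinear_scaleR _ smooth_on_const])

lemma smooth_on_divide_const:
  fixes f :: "'a::euclidean_space \<Rightarrow> real"
  shows "smooth_on UNIV f \<Longrightarrow> smooth_on UNIV (\<lambda>x. f x / c)"
  using smooth_on_mult[OF _ smooth_on_const, of f "1 / c"] by simp

lemma smooth_on_uminus:
  fixes f :: "'a::euclidean_space \<Rightarrow> real"
  shows "smooth_on UNIV f \<Longrightarrow> smooth_on UNIV (\<lambda>x. - f x)"
  using smooth_on_mult[OF smooth_on_const, of f "- 1"] by simp

lemma smooth_on_diff:
  fixes f g :: "'a::euclidean_space \<Rightarrow> real"
  shows "smooth_on UNIV f \<Longrightarrow> smooth_on UNIV g \<Longrightarrow> smooth_on UNIV (\<lambda>x. f x - g x)"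
  using smooth_on_add[OF _ smooth_on_uminus, of f g] by simp

lemma smooth_on_power:
  fixes f :: "'a::euclidean_space \<Rightarrow> real"
  shows "smooth_on UNIV f \<Longrightarrow> smooth_on UNIV (\<lambda>x. f x ^ n)"
  by (induction n) (simp_all add: smooth_on_const smooth_on_mult)

lemma smooth_on_sum:
  "finite I \<Longrightarrow> (\<And>i. i \<in> I \<Longrightarrow> smooth_on UNIV (f i)) \<Longrightarrow> smooth_on UNIV (\<lambda>x. \<Sum>i\<in>I. f i x)"
  by (induction I rule: finite_induct) (simp_all add: smooth_on_const smooth_on_add)

lemma smooth_on_bounded_linear_compose:
  fixes f :: "'a::euclidean_space \<Rightarrow> 'b::real_normed_vector" and T :: "'b \<Rightarrow> 'c::real_normed_vector"
  assumes T: "bounded_linear T" and f: "smooth_on UNIV f"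
  shows "smooth_on UNIV (\<lambda>x. T (f x))"
proof -
  have "differentiable_times_on k UNIV (\<lambda>x. T (f x))" if "smooth_on UNIV f" for k and f :: "'a \<Rightarrow> 'b"
    using that
  proof (induction k arbitrary: f)
    case 0
    then have "continuous_on UNIV f" by (metis smooth_on_def differentiable_times_on.simps(1))
    then show ?case using T by (simp add: bounded_linear.continuous_on)
  next
    case (Suc k)
    have D: "((\<lambda>x. T (f x)) has_derivative (\<lambda>v. T (frechet_derivative f (at x) v))) (at x)" for x
      using Suc.prems smooth_on_imp_differentiable frechet_derivative_works
      by (blast intro: bounded_linear.has_derivative[OF T])
    then show ?case
      using Suc.IH[OF smooth_on_frechet_derivative[OF Suc.prems]]
      unfolding differentiable_times_on.simps frechet_derivative_at[OF D, symmetric]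
      using differentiable_def by blast
  qed
  with f show ?thesis by (simp add: smooth_on_def)
qed

text \<open>Derivatives of \<open>g exp f\<close> are again of the form \<open>k exp f\<close> with \<open>k\<close> smooth.\<close>

lemma smooth_on_exp:
  fixes f :: "'a::euclidean_space \<Rightarrow> real"
  assumes f: "smooth_on UNIV f"
  shows "smooth_on UNIV (\<lambda>x. exp (f x))"
proof -
  have d: "(f has_derivative frechet_derivative f (at x)) (at x)" if "smooth_on UNIV f" for f :: "'a \<Rightarrow> real" and x
    using that smooth_on_imp_differentiable frechet_derivative_works by blast
  have "differentiable_times_on k UNIV (\<lambda>x. g x * exp (f x))" if "smooth_on UNIV g" for k and g :: "'a \<Rightarrow> real"
    using that
  proof (induction k arbitrary: g)
    case 0
    then have "continuous_on UNIV f" "continuous_on UNIV g"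
      using f by (metis smooth_on_def differentiable_times_on.simps(1))+
    then show ?case by (auto intro!: continuous_intros)
  next
    case (Suc k)
    have D: "((\<lambda>x. g x * exp (f x)) has_derivative
      (\<lambda>v. (frechet_derivative g (at x) v + g x * frechet_derivative f (at x) v) * exp (f x))) (at x)" for x
      by (rule derivative_eq_intros d[OF f] d[OF Suc.prems] refl)+ (simp add: algebra_simps)
    have "differentiable_times_on k UNIV
      (\<lambda>x. (frechet_derivative g (at x) v + g x * frechet_derivative f (at x) v) * exp (f x))" for v
      by (intro Suc.IH smooth_on_add smooth_on_mult smooth_on_frechet_derivative f Suc.prems)
    then show ?case
      unfolding differentiable_times_on.simps frechet_derivative_at[OF D, symmetric]
      using D differentiable_def by blast
  qed
  from this[OF smooth_on_const, of _ 1] show ?thesis by (simp add: smooth_on_def)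
qed

lemma vec4_eq_scaleR_sum:
  "vec4 a b c d = a *\<^sub>R ee 1 + b *\<^sub>R ee 2 + c *\<^sub>R ee 3 + d *\<^sub>R ee 4"
  by (simp add: vec_eq_iff forall_4 axis_def)

lemma smooth_on_vec4:
  "smooth_on UNIV f1 \<Longrightarrow> smooth_on UNIV f2 \<Longrightarrow> smooth_on UNIV f3 \<Longrightarrow> smooth_on UNIV f4 \<Longrightarrow>
    smooth_on UNIV (\<lambda>x. vec4 (f1 x) (f2 x) (f3 x) (f4 x))"
  unfolding vec4_eq_scaleR_sum by (intro smooth_on_add smooth_on_scaleR_const)

lemma has_derivative_vec4:
  assumes "(f1 has_derivative g1) F" "(f2 has_derivative g2) F" "(f3 has_derivative g3) F" "(f4 has_derivative g4) F"
  shows "((\<lambda>x. vec4 (f1 x) (f2 x) (f3 x) (f4 x)) has_derivative (\<lambda>v. vec4 (g1 v) (g2 v) (g3 v) (g4 v))) F"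
  unfolding vec4_eq_scaleR_sum by (intro has_derivative_add has_derivative_scaleR_left assms)

lemma smooth_on_nth: "smooth_on UNIV (\<lambda>x::real^'n. x $ i)"
  by (rule smooth_on_linear[OF bounded_linear_vec_nth])

lemma smooth_on_fst_nth: "smooth_on UNIV (\<lambda>p::(real^'n) \<times> 'b::euclidean_space. fst p $ i)"
  by (rule smooth_on_linear[OF bounded_linear_compose[OF bounded_linear_vec_nth bounded_linear_fst]])

lemma smooth_on_snd_nth: "smooth_on UNIV (\<lambda>p::'b::euclidean_space \<times> (real^'n). snd p $ i)"
  by (rule smooth_on_linear[OF bounded_linear_compose[OF bounded_linear_vec_nth bounded_linear_snd]])

lemmas smooth_intros = smooth_on_vec4 smooth_on_add smooth_on_diff smooth_on_uminus smooth_on_exp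
  smooth_on_power smooth_on_mult smooth_on_divide_const smooth_on_const smooth_on_nth smooth_on_fst_nth smooth_on_snd_nth

text \<open>The rank-one endomorphisms \<open>v \<mapsto> (v \<bullet> b) w\<close> reduce the operator-valued calculus to the pointwise one.\<close>

definition rank_one :: "'a::euclidean_space \<Rightarrow> 'b::euclidean_space \<Rightarrow> 'a \<Rightarrow>\<^sub>L 'b" where
  "rank_one b w = Blinfun (\<lambda>v. (v \<bullet> b) *\<^sub>R w)"

lemma rank_one_apply: "rank_one b w v = (v \<bullet> b) *\<^sub>R w"
proof -
  have "bounded_linear (\<lambda>v. (v \<bullet> b) *\<^sub>R w)"
    by (intro bounded_linear_scaleR_left[THEN bounded_linear_compose] bounded_linear_inner_left)
  then show ?thesis by (simp add: rank_one_def bounded_linear_Blinfun_apply)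
qed

lemma bounded_linear_rank_one: "bounded_linear (rank_one b)"
  unfolding linear_conv_bounded_linear[symmetric]
  by (intro linearI blinfun_eqI)
    (simp_all add: rank_one_apply blinfun.add_left blinfun.scaleR_left algebra_simps)

lemma Blinfun_eq_sum_rank_one:
  fixes A :: "'a::euclidean_space \<Rightarrow> 'b::euclidean_space"
  assumes "linear A"
  shows "Blinfun A = (\<Sum>b\<in>Basis. rank_one b (A b))"
proof (rule blinfun_eqI)
  fix v
  have "Blinfun A v = A (\<Sum>b\<in>Basis. (v \<bullet> b) *\<^sub>R b)"
    using assms by (simp add: bounded_linear_Blinfun_apply linear_conv_bounded_linear euclidean_representation)
  also have "\<dots> = (\<Sum>b\<in>Basis. (v \<bullet> b) *\<^sub>R A b)"
    by (simp add: linear_sum[OF assms] linear_cmul[OF assms])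
  finally show "Blinfun A v = (\<Sum>b\<in>Basis. rank_one b (A b)) v"
    by (simp add: rank_one_apply blinfun.sum_left)
qed

lemma smooth_on_Blinfun:
  fixes A :: "'c::euclidean_space \<Rightarrow> 'a::euclidean_space \<Rightarrow> 'b::euclidean_space"
  assumes "\<And>x. linear (A x)" "\<And>v. smooth_on UNIV (\<lambda>x. A x v)"
  shows "smooth_on UNIV (\<lambda>x. Blinfun (A x))"
  using assms
  by (simp add: Blinfun_eq_sum_rank_one smooth_on_sum smooth_on_bounded_linear_compose[OF bounded_linear_rank_one])

lemma has_derivative_Blinfun:
  fixes A :: "'c::real_normed_vector \<Rightarrow> 'a::euclidean_space \<Rightarrow> 'b::euclidean_space"
  assumes "\<And>x. linear (A x)" "\<And>v. linear (A' v)" "\<And>v. ((\<lambda>x. A x v) has_derivative (\<lambda>u. A' u v)) F"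
  shows "((\<lambda>x. Blinfun (A x)) has_derivative (\<lambda>u. Blinfun (A' u))) F"
  using assms
  by (simp add: Blinfun_eq_sum_rank_one has_derivative_sum bounded_linear.has_derivative[OF bounded_linear_rank_one])

lemma smooth_on_Pair:
  assumes "smooth_on UNIV f" "smooth_on UNIV g"
  shows "smooth_on UNIV (\<lambda>x. (f x, g x))"
proof -
  have "smooth_on UNIV (\<lambda>x. (f x, 0) + (0, g x))"
    by (intro smooth_on_add smooth_on_bounded_linear_compose[OF _ assms(1)] smooth_on_bounded_linear_compose[OF _ assms(2)])
      (auto intro!: bounded_linear_Pair bounded_linear_ident bounded_linear_zero)
  then show ?thesis by simp
qed

section \<open>From explicit group laws to simply transitive actions\<close>

text \<open>A group structure on \<open>real^4\<close> with left translations \<open>y \<mapsto> x + L x y\<close> and inversion \<open>J\<close>.\<close>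

locale left_affine_group =
  fixes L :: "real^4 \<Rightarrow> real^4 \<Rightarrow> real^4" and J :: "real^4 \<Rightarrow> real^4"
    and L' :: "real^4 \<Rightarrow> real^4 \<Rightarrow> real^4" and br :: "real^4 \<Rightarrow> real^4 \<Rightarrow> real^4"
  assumes linear_L: "linear (L x)" and L_0: "L 0 v = v" and L_L: "L (x + L x y) v = L x (L y v)"
    and J: "J x + L (J x) x = 0"
    and smooth_L: "smooth_on UNIV (\<lambda>p. L (fst p) (snd p))" and smooth_J: "smooth_on UNIV J"
    and derivative_L: "((\<lambda>x. L x v) has_derivative (\<lambda>u. L' u v)) (at 0)"
    and br: "br v w = L' v w - L' w v"
begin

definition grp :: "(real^4, real^4) lie_grp" where
  "grp = \<lparr>carrier = UNIV, mult = (\<lambda>x y. x + L x y), one = 0, gtop = euclidean, charts = {(UNIV, id)}\<rparr>"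

lemma grp_sel [simp]:
  "carrier grp = UNIV" "x \<otimes>\<^bsub>grp\<^esub> y = x + L x y" "\<one>\<^bsub>grp\<^esub> = 0" "gtop grp = euclidean"
  "charts grp = {(UNIV, id)}"
  by (simp_all add: grp_def)

lemma inv_into_id [simp]: "inv_into UNIV (id :: real^4 \<Rightarrow> real^4) = id"
  by (metis inv_id)

lemma group_grp: "group grp"
proof (rule groupI)
  show "\<exists>y\<in>carrier grp. y \<otimes>\<^bsub>grp\<^esub> x = \<one>\<^bsub>grp\<^esub>" for x
    using J by auto
qed (simp_all add: L_0 L_L linear_add[OF linear_L] add.assoc)

lemma inv_grp: "inv\<^bsub>grp\<^esub> x = J x"
  by (rule group.inv_equality[OF group_grp]) (simp_all add: J)

lemma J': "x + L x (J x) = 0"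
  using group.r_inv[OF group_grp, of x] by (simp add: inv_grp)

lemma lie_group_grp: "lie_group grp" and one_connected_grp: "one_connected (gtop grp)"
proof -
  have m: "smooth_on UNIV (\<lambda>(x, y). x \<otimes>\<^bsub>grp\<^esub> y)"
    by (simp add: case_prod_unfold smooth_on_add smooth_L smooth_on_linear bounded_linear_fst)
  have i: "smooth_on UNIV (\<lambda>x. inv\<^bsub>grp\<^esub> x)"
    by (simp add: inv_grp smooth_J)
  show "lie_group grp" "one_connected (gtop grp)"
    by (rule lie_group_one_chart[OF group_grp _ _ _ m i]; simp)+
qed

lemma is_lie_algebra_of_grp:
  assumes f: "linear f" "bij f" "\<And>x y. f (br0 x y) = br (f x) (f y)"
  shows "is_lie_algebra_of grp (UNIV, id) f br0"
proof -
  have "((\<lambda>y. x + L x y) has_derivative L x) (at 0)" for x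
    using bounded_linear_imp_has_derivative[OF linear_L[of x, unfolded linear_conv_bounded_linear]]
    by (auto intro!: derivative_eq_intros)
  note d = frechet_derivative_at[OF this, symmetric]
  \<comment> \<open>Left translations are affine, so their linear parts already are the
    left-invariant fields.\<close>
  have l: "left_field grp (UNIV, id) v = (\<lambda>x. L x v)" for v
    by (simp add: left_field_def d fun_eq_iff)
  have "tangent_bracket grp (UNIV, id) v w = br v w" for v w
    by (simp add: tangent_bracket_def l br frechet_derivative_at[OF derivative_L, symmetric])
  then show ?thesis using f by (simp add: is_lie_algebra_of_def)
qed

text \<open>The action is by \<open>\<rho> x = (h x, A x)\<close>, and \<open>h\<close> is the orbit
  map through 0. Its twisted multiplicativity says that \<open>\<rho>\<close> respects products, its
  bijectivity that the orbit map through one point is bijective.\<close>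

lemma simply_transitive_action_exists:
  fixes A A' :: "real^4 \<Rightarrow> real^4 \<Rightarrow> real^4" and h h' :: "real^4 \<Rightarrow> real^4"
  assumes A: "\<And>x. linear (A x)" "\<And>v. A 0 v = v" "\<And>x y v. A (x + L x y) v = A x (A y v)"
    "\<And>x u v. n4 (A x u) (A x v) = A x (n4 u v)" "\<And>v. smooth_on UNIV (\<lambda>x. A x v)"
    and h: "\<And>x y. h (x + L x y) = N4_mult (h x) (A x (h y))" "bij h" "smooth_on UNIV h"
    and A': "\<And>v. ((\<lambda>x. A x v) has_derivative (\<lambda>u. A' u v)) (at 0)"
    and h': "(h has_derivative h') (at 0)"
    and rep: "n4_rep br h' A'" and iso: "lie_isomorphic br0 br"
  shows "\<exists>\<phi>. simply_transitive_action br0 N4 n4 \<phi>"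
proof -
  interpret rep: n4_rep br h' A' by (rule rep)
  obtain f where f: "linear f" "bij f" "\<And>x y. f (br0 x y) = br (f x) (f y)"
    using iso unfolding lie_isomorphic_def by blast
  define \<phi> where "\<phi> v = (h' v, Blinfun (A' v))" for v
  have B: "Blinfun (A' v) u = A' v u" for u v
    using rep.linear_D_apply by (simp add: bounded_linear_Blinfun_apply linear_conv_bounded_linear)
  have \<phi>: "aff_morphism br0 n4 (\<phi> \<circ> f)"
    unfolding aff_morphism_def
  proof (intro conjI allI)
    have "linear \<phi>"
      by (intro linearI) (auto intro!: blinfun_eqI simp: \<phi>_def linear_add[OF rep.linear_t] linear_cmul[OF rep.linear_t]
        linear_add[OF rep.linear_D] linear_cmul[OF rep.linear_D] B blinfun.add_left blinfun.scaleR_left)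
    then show "linear (\<phi> \<circ> f)" using f(1) linear_compose by blast
    show "range (\<phi> \<circ> f) \<subseteq> aff_carrier n4"
      by (auto simp: aff_carrier_def \<phi>_def derivations_def B rep.D_n4)
    show "(\<phi> \<circ> f) (br0 x y) = aff_bracket n4 ((\<phi> \<circ> f) x) ((\<phi> \<circ> f) y)" for x y
      by (auto intro!: blinfun_eqI simp: f(3) aff_bracket_def \<phi>_def B rep.t_br rep.D_br blinfun.diff_left)
  qed
  define \<rho> where "\<rho> x = (h x, A x)" for x
  have AJ: "A x (A (J x) v) = v" "A (J x) (A x v) = v" for x v
    using A(3)[of x "J x" v] A(3)[of "J x" x v] by (simp_all add: J J' A(2))
  have aut: "A x \<in> lie_automorphisms N4" for x
  proof -
    have "bij (A x)" using AJ by (metis bijI')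
    moreover have "inv_into UNIV (A x) = A (J x)"
      by (intro ext inv_f_eq) (simp_all add: AJ \<open>bij (A x)\<close> bij_is_inj)
    moreover have "A x (N4_mult u v) = N4_mult (A x u) (A x v)" for u v
      by (simp add: N4_mult_def linear_add[OF A(1)] linear_cmul[OF A(1)] A(4))
    ultimately show ?thesis
      using A(1) by (simp add: lie_automorphisms_def iso_def hom_def smooth_on_linear linear_conv_bounded_linear)
  qed
  have coord: "aff_coord (\<rho> x) = (h x, Blinfun (A x))" for x
    by (simp add: aff_coord_def \<rho>_def lie_automorphism_N4_eq_derivative(1)[OF aut])
  have hom: "smooth_hom_to_aff grp N4 \<rho>"
  proof -
    have "\<rho> \<in> hom grp (aff_group N4)"
      by (simp add: hom_def aff_group_def \<rho>_def aut h(1) A(3) fun_eq_iff)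
    moreover have "smooth_on UNIV (\<lambda>x. aff_coord (\<rho> x))"
      unfolding coord by (intro smooth_on_Pair h smooth_on_Blinfun A)
    ultimately show ?thesis by (simp add: smooth_hom_to_aff_def o_def)
  qed
  have diff: "differential_at_one grp (UNIV, id) \<rho> v = \<phi> v" for v
  proof -
    have "((\<lambda>x. (h x, Blinfun (A x))) has_derivative \<phi>) (at 0)"
      unfolding \<phi>_def by (intro has_derivative_Pair h' has_derivative_Blinfun A A' rep.linear_D_apply)
    from frechet_derivative_at[OF this, symmetric] show ?thesis
      by (simp add: differential_at_one_def o_def coord)
  qed
  have trans: "simply_transitive_on grp N4 \<rho>"
    unfolding simply_transitive_on_def
  proof (intro allI)
    fix x y
    \<comment> \<open>The orbit map through \<open>h k\<close> is \<open>h\<close> after right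
      multiplication by \<open>k\<close>, so bijectivity passes to every point.\<close>
    obtain k where k: "h k = x" using h(2) by (metis bij_pointE)
    have act: "aff_act N4 (\<rho> g) x = h (g \<otimes>\<^bsub>grp\<^esub> k)" for g
      by (simp add: aff_act_def \<rho>_def h(1) k)
    obtain z where z: "h z = y" using h(2) by (metis bij_pointE)
    interpret G: group grp by (rule group_grp)
    have e: "z \<otimes>\<^bsub>grp\<^esub> inv\<^bsub>grp\<^esub> k \<otimes>\<^bsub>grp\<^esub> k = z"
      by (metis G.m_assoc G.l_inv G.r_one G.inv_closed UNIV_I grp_sel(1))
    show "\<exists>!g. g \<in> carrier grp \<and> aff_act N4 (\<rho> g) x = y"
    proof (rule ex1I[of _ "z \<otimes>\<^bsub>grp\<^esub> inv\<^bsub>grp\<^esub> k"])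
      show "z \<otimes>\<^bsub>grp\<^esub> inv\<^bsub>grp\<^esub> k \<in> carrier grp \<and> aff_act N4 (\<rho> (z \<otimes>\<^bsub>grp\<^esub> inv\<^bsub>grp\<^esub> k)) x = y"
        unfolding act e using z by simp
    next
      fix g assume "g \<in> carrier grp \<and> aff_act N4 (\<rho> g) x = y"
      then have "g \<otimes>\<^bsub>grp\<^esub> k = z" using h(2) z unfolding act by (metis bij_is_inj injD)
      then show "g = z \<otimes>\<^bsub>grp\<^esub> inv\<^bsub>grp\<^esub> k" using G.inv_solve_right[of g z k] by simp
    qed
  qed
  have "simply_transitive_action br0 N4 n4 (\<phi> \<circ> f)"
    unfolding simply_transitive_action_def
    using \<phi> lie_group_grp one_connected_grp is_lie_algebra_of_grp[OF f] hom diff trans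
    by (intro conjI exI[of _ grp] exI[of _ "(UNIV, id)"] exI[of _ f] exI[of _ \<rho>]) simp_all
  then show ?thesis by blast
qed

end

section \<open>The five explicit actions\<close>

lemma has_derivative_nth [derivative_intros]:
  "((\<lambda>x::real^'n. x $ i) has_derivative (\<lambda>v. v $ i)) F"
  by (rule bounded_linear_imp_has_derivative[OF bounded_linear_vec_nth])

text \<open>The group laws \<open>x + r4_trans \<mu> x y\<close> and \<open>x + d4l_trans \<mu> x y\<close> are written in the coordinates
  \<open>exp (x\<^sub>4 e\<^sub>4) exp (x\<^sub>3 e\<^sub>3) exp (x\<^sub>2 e\<^sub>2) exp (x\<^sub>1 e\<^sub>1)\<close>.\<close>

definition r4_trans :: "real \<Rightarrow> real^4 \<Rightarrow> real^4 \<Rightarrow> real^4" where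
  "r4_trans \<mu> x y = vec4 (y$1) (exp (x$1) * y$2) (exp (\<mu> * x$1) * (y$3 + x$1 * y$4)) (exp (\<mu> * x$1) * y$4)"

definition d4l_trans :: "real \<Rightarrow> real^4 \<Rightarrow> real^4 \<Rightarrow> real^4" where
  "d4l_trans \<mu> x y = vec4 (y$1) (exp (\<mu> * x$1) * y$2) (exp ((1 - \<mu>) * x$1) * y$3)
     (exp (x$1) * y$4 + x$2 * (exp ((1 - \<mu>) * x$1) * y$3))"

lemma left_affine_group_r4:
  "left_affine_group (r4_trans \<mu>)
     (\<lambda>x. vec4 (- x$1) (- (exp (- x$1) * x$2)) (- (exp (- (\<mu> * x$1)) * (x$3 - x$1 * x$4))) (- (exp (- (\<mu> * x$1)) * x$4)))
     (\<lambda>u v. vec4 0 (u$1 * v$2) (\<mu> * u$1 * v$3 + u$1 * v$4) (\<mu> * u$1 * v$4)) (r4 \<mu>)"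
proof
  show "smooth_on UNIV (\<lambda>p. r4_trans \<mu> (fst p) (snd p))"
    unfolding r4_trans_def by (intro smooth_intros)
  show "((\<lambda>x. r4_trans \<mu> x v) has_derivative
      (\<lambda>u. vec4 0 (u$1 * v$2) (\<mu> * u$1 * v$3 + u$1 * v$4) (\<mu> * u$1 * v$4))) (at 0)" for v
    unfolding r4_trans_def
    by (rule has_derivative_vec4; (rule derivative_eq_intros refl)+; simp add: fun_eq_iff algebra_simps)
qed (intro smooth_intros | simp add: r4_trans_def vec4_simps r4_def axis_def exp_add exp_minus algebra_simps field_simps)+

lemma left_affine_group_d4l:
  "left_affine_group (d4l_trans \<mu>)
     (\<lambda>x. vec4 (- x$1) (- (exp (- (\<mu> * x$1)) * x$2)) (- (exp (- ((1 - \<mu>) * x$1)) * x$3)) (exp (- x$1) * (x$2 * x$3 - x$4)))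
     (\<lambda>u v. vec4 0 (\<mu> * u$1 * v$2) ((1 - \<mu>) * u$1 * v$3) (u$1 * v$4 + u$2 * v$3)) (d4l \<mu>)"
proof
  show "smooth_on UNIV (\<lambda>p. d4l_trans \<mu> (fst p) (snd p))"
    unfolding d4l_trans_def by (intro smooth_intros)
  show "((\<lambda>x. d4l_trans \<mu> x v) has_derivative
      (\<lambda>u. vec4 0 (\<mu> * u$1 * v$2) ((1 - \<mu>) * u$1 * v$3) (u$1 * v$4 + u$2 * v$3))) (at 0)" for v
    unfolding d4l_trans_def
    by (rule has_derivative_vec4; (rule derivative_eq_intros refl)+; simp add: fun_eq_iff algebra_simps)
qed (intro smooth_intros | simp add: d4l_trans_def vec4_simps d4l_def axis_def exp_add exp_minus exp_diff algebra_simps field_simps)+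

text \<open>In each case \<open>\<phi> v = (h' v, A' v)\<close>, and \<open>(h x, A x)\<close> is the product of the four factors
  \<open>exp (x\<^sub>i \<phi> e\<^sub>i) = (x\<^sub>i h' e\<^sub>i, exp (x\<^sub>i A' e\<^sub>i))\<close>, the latter because \<open>A' e\<^sub>i\<close> kills \<open>h' e\<^sub>i\<close>.\<close>

lemma simply_transitive_action_r4_1:
  assumes "lie_isomorphic br (r4 1)"
  shows "\<exists>\<phi>. simply_transitive_action br N4 n4 \<phi>"
proof -
  define A where "A x v = vec4 (v$1) (exp (x$1) * v$2) (exp (x$1) * (v$3 - x$1 * v$2)) (exp (x$1) * (v$4 - x$1 * v$3 + (x$1 + (x$1)^2 / 2) * v$2))" for x v :: "real^4"
  \<comment> \<open>\<open>h'\<close> sends \<open>e_1\<close> to \<open>f_1\<close> and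
    \<open>e_4\<close> to \<open>f_2\<close>. The subdiagonal entries \<open>-1\<close> of
    \<open>A' e_1\<close> cancel \<open>ad f_1\<close>, and its entry \<open>1\<close> from
    \<open>f_2\<close> to \<open>f_4\<close> creates the Jordan block.\<close>
  define A' where "A' u v = vec4 0 (u$1 * v$2) (u$1 * (v$3 - v$2)) (u$1 * (v$4 - v$3 + v$2))" for u v :: "real^4"
  define h where "h x = vec4 (x$1) (x$4) (x$2 - x$1 * x$4 / 2) (x$3 - x$1 * x$2 / 2 + (x$1)^2 * x$4 / 12)" for x :: "real^4"
  define h' where "h' x = vec4 (x$1) (x$4) (x$2) (x$3)" for x :: "real^4"
  define k where "k x = vec4 (x$1) (x$3 + x$1 * x$2 / 2) (x$4 + x$1 * (x$3 + x$1 * x$2 / 2) / 2 - (x$1)^2 * x$2 / 12) (x$2)" for x :: "real^4"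
  note exps = exp_add exp_minus exp_diff add_divide_distrib diff_divide_distrib
  note simps = vec4_simps axis_def power2_eq_square
  show ?thesis
  proof (rule left_affine_group.simply_transitive_action_exists[OF left_affine_group_r4])
    show "lie_isomorphic br (r4 1)" by (rule assms)
    show "linear (A x)" for x
      by (intro linearI) (simp_all add: A_def vec4_simps algebra_simps)
    show "A 0 v = v" for v by (simp add: A_def simps)
    show "A (x + r4_trans 1 x y) v = A x (A y v)" for x y v
      by (simp add: A_def r4_trans_def simps exps) (simp add: field_simps)
    show "n4 (A x u) (A x v) = A x (n4 u v)" for x u v
      by (simp add: A_def simps exps) (simp add: field_simps)
    show "smooth_on UNIV (\<lambda>x. A x v)" for v
      unfolding A_def by (intro smooth_intros)
    show "h (x + r4_trans 1 x y) = N4_mult (h x) (A x (h y))" for x y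
      by (simp add: A_def h_def N4_mult_def r4_trans_def simps exps) (simp add: field_simps)
    have "h \<circ> k = id" "k \<circ> h = id"
      by (simp_all add: h_def k_def simps fun_eq_iff field_simps)
    then show "bij h" using o_bij by blast
    show "smooth_on UNIV h"
      unfolding h_def by (intro smooth_intros)
    show "((\<lambda>x. A x v) has_derivative (\<lambda>u. A' u v)) (at 0)" for v
      unfolding A_def A'_def
      by (rule has_derivative_vec4; (rule derivative_eq_intros refl | simp)+; simp add: fun_eq_iff algebra_simps)
    show "(h has_derivative h') (at 0)"
      unfolding h_def h'_def
      by (rule has_derivative_vec4; (rule derivative_eq_intros refl | simp)+; simp add: fun_eq_iff algebra_simps)
    show "n4_rep (r4 1) h' A'"
      by (intro n4_rep.intro linearI)
        (simp_all add: A'_def h'_def r4_def simps algebra_simps)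
  qed
qed

lemma simply_transitive_action_d4l_half:
  assumes "lie_isomorphic br (d4l (1/2))"
  shows "\<exists>\<phi>. simply_transitive_action br N4 n4 \<phi>"
proof -
  define A where "A x v = vec4 (exp (x$1 / 2) * v$1) (v$2) (exp (x$1 / 2) * (v$3 + x$1 * v$1)) (exp (x$1) * v$4)" for x v :: "real^4"
  \<comment> \<open>\<open>h'\<close> sends \<open>e_1\<close> to \<open>f_2\<close>; the
    off-diagonal entry \<open>1\<close> of \<open>A' e_1\<close> cancels
    \<open>[f_2, f_1] = - f_3\<close>.\<close>
  define A' where "A' u v = vec4 (u$1 * v$1 / 2) 0 (u$1 * (v$1 + v$3 / 2)) (u$1 * v$4)" for u v :: "real^4"
  define h where "h x = vec4 (x$2) (x$1) (x$3 + x$1 * x$2 / 2) (x$4 - x$2 * x$3 / 2 + x$1 * (x$2)^2 / 12)" for x :: "real^4"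
  define h' where "h' x = vec4 (x$2) (x$1) (x$3) (x$4)" for x :: "real^4"
  define k where "k x = vec4 (x$2) (x$1) (x$3 - x$1 * x$2 / 2) (x$4 + x$1 * (x$3 - x$1 * x$2 / 2) / 2 - (x$1)^2 * x$2 / 12)" for x :: "real^4"
  \<comment> \<open>\<open>exp (x$1)\<close> is rewritten as a power of
    \<open>exp (x$1 / 2)\<close>, so that a single exponential atom remains.\<close>
  note exps = exp_add exp_minus exp_diff exp_double[of "x $ 1 / 2" for x :: "real^4", simplified] add_divide_distrib diff_divide_distrib
  note simps = vec4_simps axis_def power2_eq_square
  show ?thesis
  proof (rule left_affine_group.simply_transitive_action_exists[OF left_affine_group_d4l])
    show "lie_isomorphic br (d4l (1/2))" by (rule assms)
    show "linear (A x)" for x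
      by (intro linearI) (simp_all add: A_def vec4_simps algebra_simps)
    show "A 0 v = v" for v by (simp add: A_def simps)
    show "A (x + d4l_trans (1/2) x y) v = A x (A y v)" for x y v
      by (simp add: A_def d4l_trans_def simps exps) (simp add: field_simps)
    show "n4 (A x u) (A x v) = A x (n4 u v)" for x u v
      by (simp add: A_def simps exps) (simp add: field_simps)
    show "smooth_on UNIV (\<lambda>x. A x v)" for v
      unfolding A_def by (intro smooth_intros)
    show "h (x + d4l_trans (1/2) x y) = N4_mult (h x) (A x (h y))" for x y
      by (simp add: A_def h_def N4_mult_def d4l_trans_def simps exps) (simp add: field_simps)
    have "h \<circ> k = id" "k \<circ> h = id"
      by (simp_all add: h_def k_def simps fun_eq_iff field_simps)
    then show "bij h" using o_bij by blast
    show "smooth_on UNIV h"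
      unfolding h_def by (intro smooth_intros)
    show "((\<lambda>x. A x v) has_derivative (\<lambda>u. A' u v)) (at 0)" for v
      unfolding A_def A'_def
      by (rule has_derivative_vec4; (rule derivative_eq_intros refl | simp)+; simp add: fun_eq_iff algebra_simps)
    show "(h has_derivative h') (at 0)"
      unfolding h_def h'_def
      by (rule has_derivative_vec4; (rule derivative_eq_intros refl | simp)+; simp add: fun_eq_iff algebra_simps)
    show "n4_rep (d4l (1/2)) h' A'"
      by (intro n4_rep.intro linearI)
        (simp_all add: A'_def h'_def d4l_def simps field_simps)
  qed
qed

lemma simply_transitive_action_r4_minus_1:
  assumes "lie_isomorphic br (r4 (-1))"
  shows "\<exists>\<phi>. simply_transitive_action br N4 n4 \<phi>"
proof -
  define A where "A x v = vec4 (exp (- x$1) * v$1) (exp (x$1) * v$2) (v$3 + exp (- x$1) * x$2 * v$1) (exp (- x$1) * v$4)" for x v :: "real^4"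
  \<comment> \<open>\<open>h'\<close> sends \<open>e_1\<close> to \<open>f_3\<close>, and
    \<open>[f_3, f_1] = - f_4\<close> itself supplies the Jordan block. \<open>A' e_2\<close> is
    there to cancel \<open>[f_2, f_1]\<close>, as \<open>e_2\<close> and \<open>e_4\<close>
    commute.\<close>
  define A' where "A' u v = vec4 (- (u$1 * v$1)) (u$1 * v$2) (u$2 * v$1) (- (u$1 * v$4))" for u v :: "real^4"
  define h where "h x = vec4 (x$4) (x$2) (x$1 + x$2 * x$4 / 2) (- x$3 + x$1 * x$4 / 2 + x$2 * (x$4)^2 / 12)" for x :: "real^4"
  define h' where "h' x = vec4 (x$4) (x$2) (x$1) (- x$3)" for x :: "real^4"
  define k where "k x = vec4 (x$3 - x$1 * x$2 / 2) (x$2) (- x$4 + (x$3 - x$1 * x$2 / 2) * x$1 / 2 + (x$1)^2 * x$2 / 12) (x$1)" for x :: "real^4"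
  note exps = exp_add exp_minus exp_diff add_divide_distrib diff_divide_distrib
  note simps = vec4_simps axis_def power2_eq_square
  show ?thesis
  proof (rule left_affine_group.simply_transitive_action_exists[OF left_affine_group_r4])
    show "lie_isomorphic br (r4 (-1))" by (rule assms)
    show "linear (A x)" for x
      by (intro linearI) (simp_all add: A_def vec4_simps algebra_simps)
    show "A 0 v = v" for v by (simp add: A_def simps)
    show "A (x + r4_trans (-1) x y) v = A x (A y v)" for x y v
      by (simp add: A_def r4_trans_def simps exps) (simp add: field_simps)
    show "n4 (A x u) (A x v) = A x (n4 u v)" for x u v
      by (simp add: A_def simps exps) (simp add: field_simps)
    show "smooth_on UNIV (\<lambda>x. A x v)" for v
      unfolding A_def by (intro smooth_intros)
    show "h (x + r4_trans (-1) x y) = N4_mult (h x) (A x (h y))" for x y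
      by (simp add: A_def h_def N4_mult_def r4_trans_def simps exps) (simp add: field_simps)
    have "h \<circ> k = id" "k \<circ> h = id"
      by (simp_all add: h_def k_def simps fun_eq_iff field_simps)
    then show "bij h" using o_bij by blast
    show "smooth_on UNIV h"
      unfolding h_def by (intro smooth_intros)
    show "((\<lambda>x. A x v) has_derivative (\<lambda>u. A' u v)) (at 0)" for v
      unfolding A_def A'_def
      by (rule has_derivative_vec4; (rule derivative_eq_intros refl | simp)+; simp add: fun_eq_iff algebra_simps)
    show "(h has_derivative h') (at 0)"
      unfolding h_def h'_def
      by (rule has_derivative_vec4; (rule derivative_eq_intros refl | simp)+; simp add: fun_eq_iff algebra_simps)
    show "n4_rep (r4 (-1)) h' A'"
      by (intro n4_rep.intro linearI)
        (simp_all add: A'_def h'_def r4_def simps field_simps)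
  qed
qed

lemma simply_transitive_action_r4_half:
  assumes "lie_isomorphic br (r4 (1/2))"
  shows "\<exists>\<phi>. simply_transitive_action br N4 n4 \<phi>"
proof -
  define A where "A x v = vec4 (exp (x$1 / 2) * v$1) (v$2) (exp (x$1 / 2) * (v$3 + 4/3 * x$1 * v$1) + x$4 * v$2)
     (exp (x$1 / 2) * (4/3 * (x$1 * x$4 - x$3) * v$1 + x$4 * v$3) + (x$4)^2 / 2 * v$2 + exp (x$1) * v$4)" for x v :: "real^4"
  \<comment> \<open>Let \<open>A' e_1\<close> send \<open>f_1\<close> to
    \<open>f_1 / 2 + c f_3\<close>, let \<open>A' e_4\<close> send \<open>f_2\<close> to
    \<open>f_3\<close>, and put \<open>h' e_3 = s f_3\<close>. The bracket \<open>[e_1, e_4]\<close>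
    requires \<open>s = c - 2\<close> and \<open>A' e_3 f_1 = - c f_4\<close>; then
    \<open>[e_3, e_4] = 0\<close> requires \<open>- c = 2 s\<close>. Hence \<open>c = 4/3\<close>
    and \<open>s = - 2/3\<close>.\<close>
  define A' where "A' u v = vec4 (u$1 * v$1 / 2) 0 (u$1 * (4/3 * v$1 + v$3 / 2) + u$4 * v$2) (u$4 * v$3 - 4/3 * u$3 * v$1 + u$1 * v$4)" for u v :: "real^4"
  define h where "h x = vec4 (x$4) (x$1) (3/2 * x$1 * x$4 - 2/3 * x$3) (x$2 - x$3 * x$4 + 13/12 * x$1 * (x$4)^2)" for x :: "real^4"
  define h' where "h' x = vec4 (x$4) (x$1) (- (2/3 * x$3)) (x$2)" for x :: "real^4"
  define k where "k x = vec4 (x$2) (x$4 + 3/2 * (3/2 * x$1 * x$2 - x$3) * x$1 - 13/12 * (x$1)^2 * x$2) (3/2 * (3/2 * x$1 * x$2 - x$3)) (x$1)" for x :: "real^4"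
  note exps = exp_add exp_minus exp_diff exp_double[of "x $ 1 / 2" for x :: "real^4", simplified] add_divide_distrib diff_divide_distrib
  note simps = vec4_simps axis_def power2_eq_square
  show ?thesis
  proof (rule left_affine_group.simply_transitive_action_exists[OF left_affine_group_r4])
    show "lie_isomorphic br (r4 (1/2))" by (rule assms)
    show "linear (A x)" for x
      by (intro linearI) (simp_all add: A_def vec4_simps field_simps)
    show "A 0 v = v" for v by (simp add: A_def simps)
    show "A (x + r4_trans (1/2) x y) v = A x (A y v)" for x y v
      by (simp add: A_def r4_trans_def simps exps) (simp add: field_simps)
    show "n4 (A x u) (A x v) = A x (n4 u v)" for x u v
      by (simp add: A_def simps exps) (simp add: field_simps)
    show "smooth_on UNIV (\<lambda>x. A x v)" for v
      unfolding A_def by (intro smooth_intros)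
    show "h (x + r4_trans (1/2) x y) = N4_mult (h x) (A x (h y))" for x y
      by (simp add: A_def h_def N4_mult_def r4_trans_def simps exps) (simp add: field_simps)
    have "h \<circ> k = id" "k \<circ> h = id"
      by (simp_all add: h_def k_def simps fun_eq_iff field_simps)
    then show "bij h" using o_bij by blast
    show "smooth_on UNIV h"
      unfolding h_def by (intro smooth_intros)
    show "((\<lambda>x. A x v) has_derivative (\<lambda>u. A' u v)) (at 0)" for v
      unfolding A_def A'_def
      by (rule has_derivative_vec4; (rule derivative_eq_intros refl | simp)+; simp add: fun_eq_iff algebra_simps)
    show "(h has_derivative h') (at 0)"
      unfolding h_def h'_def
      by (rule has_derivative_vec4; (rule derivative_eq_intros refl | simp)+; simp add: fun_eq_iff algebra_simps)
    show "n4_rep (r4 (1/2)) h' A'"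
      by (intro n4_rep.intro linearI)
        (simp_all add: A'_def h'_def r4_def simps field_simps)
  qed
qed

lemma simply_transitive_action_d4l_2:
  assumes "lie_isomorphic br (d4l 2)"
  shows "\<exists>\<phi>. simply_transitive_action br N4 n4 \<phi>"
proof -
  define A where "A x v = vec4 (exp (- x$1) * v$1) (exp (2 * x$1) * v$2) (exp (- x$1) * (4/3 * x$2 * v$1) + exp (2 * x$1) * x$3 * v$2 + exp (x$1) * v$3)
     (exp (- x$1) * (4/3 * (x$2 * x$3 - x$4) * v$1) + exp (2 * x$1) * ((x$3)^2 / 2 * v$2) + exp (x$1) * x$3 * v$3 + v$4)" for x v :: "real^4"
  \<comment> \<open>The relations among \<open>e_2, e_3, e_4\<close> lead to the same equations,
    with \<open>e_2, e_4, e_3\<close> in the roles that \<open>e_1, e_3, e_4\<close> have for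
    \<open>r4 (1/2)\<close>; hence again \<open>4/3\<close> and \<open>- 2/3\<close>. Now
    \<open>e_1\<close> goes to the kernel vector \<open>f_4\<close>, which is central.\<close>
  define A' where "A' u v = vec4 (- (u$1 * v$1)) (2 * u$1 * v$2) (4/3 * u$2 * v$1 + u$3 * v$2 + u$1 * v$3) (u$3 * v$3 - 4/3 * u$4 * v$1)" for u v :: "real^4"
  define h where "h x = vec4 (x$3) (x$2) (3/2 * x$2 * x$3 - 2/3 * x$4) (x$1 - x$3 * x$4 + 13/12 * x$2 * (x$3)^2)" for x :: "real^4"
  define h' where "h' x = vec4 (x$3) (x$2) (- (2/3 * x$4)) (x$1)" for x :: "real^4"
  define k where "k x = vec4 (x$4 + 3/2 * (3/2 * x$1 * x$2 - x$3) * x$1 - 13/12 * (x$1)^2 * x$2) (x$2) (x$1) (3/2 * (3/2 * x$1 * x$2 - x$3))" for x :: "real^4"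
  note exps = exp_double exp_add exp_minus exp_diff add_divide_distrib diff_divide_distrib
  note simps = vec4_simps axis_def power2_eq_square
  show ?thesis
  proof (rule left_affine_group.simply_transitive_action_exists[OF left_affine_group_d4l])
    show "lie_isomorphic br (d4l 2)" by (rule assms)
    show "linear (A x)" for x
      by (intro linearI) (simp_all add: A_def vec4_simps field_simps)
    show "A 0 v = v" for v by (simp add: A_def simps)
    show "A (x + d4l_trans 2 x y) v = A x (A y v)" for x y v
      by (simp add: A_def d4l_trans_def simps exps) (simp add: field_simps)
    show "n4 (A x u) (A x v) = A x (n4 u v)" for x u v
      by (simp add: A_def simps exps) (simp add: field_simps)
    show "smooth_on UNIV (\<lambda>x. A x v)" for v
      unfolding A_def by (intro smooth_intros)
    show "h (x + d4l_trans 2 x y) = N4_mult (h x) (A x (h y))" for x y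
      by (simp add: A_def h_def N4_mult_def d4l_trans_def simps exps) (simp add: field_simps)
    have "h \<circ> k = id" "k \<circ> h = id"
      by (simp_all add: h_def k_def simps fun_eq_iff field_simps)
    then show "bij h" using o_bij by blast
    show "smooth_on UNIV h"
      unfolding h_def by (intro smooth_intros)
    show "((\<lambda>x. A x v) has_derivative (\<lambda>u. A' u v)) (at 0)" for v
      unfolding A_def A'_def
      by (rule has_derivative_vec4; (rule derivative_eq_intros refl | simp)+; simp add: fun_eq_iff algebra_simps)
    show "(h has_derivative h') (at 0)"
      unfolding h_def h'_def
      by (rule has_derivative_vec4; (rule derivative_eq_intros refl | simp)+; simp add: fun_eq_iff algebra_simps)
    show "n4_rep (d4l 2) h' A'"
      by (intro n4_rep.intro linearI)
        (simp_all add: A'_def h'_def d4l_def simps field_simps)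
  qed
qed

theorem proposition6p3:
  fixes br :: "'g::real_vector \<Rightarrow> 'g \<Rightarrow> 'g"
  assumes "lie_algebra br"
    and "lie_isomorphic br rr3 \<or> (\<exists>\<mu>. lie_isomorphic br (r4 \<mu>)) \<or> lie_isomorphic br d4 \<or>
      (\<exists>\<mu>\<ge>1/2. lie_isomorphic br (d4l \<mu>)) \<or> (\<exists>\<mu>\<ge>0. lie_isomorphic br (d4l' \<mu>))"
  shows "(\<exists>\<phi>. simply_transitive_action br N4 n4 \<phi>) \<longleftrightarrow>
    (\<exists>\<mu>\<in>{-1, 1/2, 1}. lie_isomorphic br (r4 \<mu>)) \<or> (\<exists>\<mu>\<in>{1/2, 2}. lie_isomorphic br (d4l \<mu>))"
proof
  assume "\<exists>\<phi>. simply_transitive_action br N4 n4 \<phi>"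
  then obtain \<phi> where "simply_transitive_action br N4 n4 \<phi>" ..
  then interpret n4_etale_rep br "\<lambda>x. fst (\<phi> x)" "\<lambda>x. blinfun_apply (snd (\<phi> x))"
    by (rule simply_transitive_action_imp_n4_etale_rep)
  show "(\<exists>\<mu>\<in>{-1, 1/2, 1}. lie_isomorphic br (r4 \<mu>)) \<or> (\<exists>\<mu>\<in>{1/2, 2}. lie_isomorphic br (d4l \<mu>))"
    using assms(2) not_rr3 not_d4 not_d4l' r4_cases d4l_cases by blast
next
  assume "(\<exists>\<mu>\<in>{-1, 1/2, 1}. lie_isomorphic br (r4 \<mu>)) \<or> (\<exists>\<mu>\<in>{1/2, 2}. lie_isomorphic br (d4l \<mu>))"
  then show "\<exists>\<phi>. simply_transitive_action br N4 n4 \<phi>"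
    using simply_transitive_action_r4_1 simply_transitive_action_r4_half simply_transitive_action_r4_minus_1
      simply_transitive_action_d4l_half simply_transitive_action_d4l_2 by auto
qed

end
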